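(* The following assertions are equivalent: (1) there exists a nonmetrizable $\mathbb R^{\omega_1}$-factorizable space; (2) there exists a countable nonmetrizable $\mathbb R^{\omega_1}$-factorizable space with a single nonisolated point; (3) there exists a countable nonmetrizable $\mathbb R^{\omega_1}$-factorizable space of weight $\omega_2$ with a single nonisolated point; (4) there exists a nonmetrizable $\mathbb R^{\omega_1}$-factorizable topological group.
   Context: All topological spaces (including those underlying topological groups and the second-countable spaces below) are assumed to be Tychonoff (completely regular Hausdorff). A space $X$ is $\mathbb R^{\omega_1}$-factorizable if for every continuous function $f\colon X\to\mathbb R^{\omega_1}$ there exist a second-countable space $Y$ and continuous functions $h\colon X\to Y$ and $g\colon Y\to\mathbb R^{\omega_1}$ such that $f=g\circ h$. A topological group is called $\mathbb R^{\omega_1}$-factorizable if its underlying topological space is. The weight of a space is the minimum cardinality of a base of its topology. *)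

theory Defs
  imports "HOL-Analysis.Analysis" "HOL-Algebra.Group"
begin

unbundle cardinal_syntax

definition tychonoff_space :: "'a topology \<Rightarrow> bool" where
  "tychonoff_space X \<longleftrightarrow> completely_regular_space X \<and> Hausdorff_space X"

abbreviation omega1 :: "nat set rel" where
  "omega1 \<equiv> cardSuc natLeq"

abbreviation omega2 :: "nat set set rel" where
  "omega2 \<equiv> cardSuc omega1"

(* The underlying set of omega1 is Field omega1, a well-ordered set of cardinality aleph_1. *)
abbreviation R_pow_omega1 :: "(nat set \<Rightarrow> real) topology" where
  "R_pow_omega1 \<equiv> product_topology (\<lambda>_. euclideanreal) (Field omega1)"

(* HOL cannot quantify over the carrier type of Y here.  Taking Y to live on a set of reals
   loses nothing, because a second-countable Hausdorff space has at most continuum many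
   points; see factor_through_real below. *)
definition R_omega1_factorizable :: "'a topology \<Rightarrow> bool" where
  "R_omega1_factorizable X \<longleftrightarrow>
     (\<forall>f. continuous_map X R_pow_omega1 f \<longrightarrow>
        (\<exists>(Y :: real topology) h g.
           tychonoff_space Y \<and> second_countable Y \<and>
           continuous_map X Y h \<and> continuous_map Y R_pow_omega1 g \<and>
           (\<forall>x \<in> topspace X. f x = (g \<circ> h) x)))"

definition is_base :: "'a set set \<Rightarrow> 'a topology \<Rightarrow> bool" where
  "is_base \<B> X \<longleftrightarrow>
     (\<forall>V \<in> \<B>. openin X V) \<and>
     (\<forall>U x. openin X U \<and> x \<in> U \<longrightarrow> (\<exists>V \<in> \<B>. x \<in> V \<and> V \<subseteq> U))"

definition has_weight :: "'a topology \<Rightarrow> 'k rel \<Rightarrow> bool" where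
  "has_weight X \<kappa> \<longleftrightarrow>
     (\<exists>\<B>. is_base \<B> X \<and> |\<B>| =o \<kappa>) \<and> (\<forall>\<B>. is_base \<B> X \<longrightarrow> \<kappa> \<le>o |\<B>| )"

definition single_nonisolated_point :: "'a topology \<Rightarrow> bool" where
  "single_nonisolated_point X \<longleftrightarrow> (\<exists>!p. p \<in> topspace X \<and> \<not> openin X {p})"

definition topological_group :: "('a, 'm) monoid_scheme \<Rightarrow> 'a topology \<Rightarrow> bool" where
  "topological_group G T \<longleftrightarrow>
     group G \<and> topspace T = carrier G \<and>
     continuous_map (prod_topology T T) T (\<lambda>(x, y). x \<otimes>\<^bsub>G\<^esub> y) \<and>
     continuous_map T T (\<lambda>x. inv\<^bsub>G\<^esub> x)"

lemma second_countable_Hausdorff_real_copy: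
  fixes Y :: "'c topology"
  assumes "second_countable Y" "Hausdorff_space Y"
  shows "\<exists>Z :: real topology. Y homeomorphic_space Z"
proof -
  obtain \<B> where cB: "countable \<B>" and opB: "\<And>V. V \<in> \<B> \<Longrightarrow> openin Y V"
    and B: "\<And>U x. openin Y U \<Longrightarrow> x \<in> U \<Longrightarrow> \<exists>V \<in> \<B>. x \<in> V \<and> V \<subseteq> U"
    using assms(1) unfolding second_countable_def by metis
  obtain r :: "nat set \<Rightarrow> real" where r: "inj r"
    using nat_sets_eqpoll_reals unfolding eqpoll_def bij_betw_def by blast
  define e where "e = (\<lambda>x. r (to_nat_on \<B> ` {V \<in> \<B>. x \<in> V}))"
  have inj: "inj_on e (topspace Y)"
  proof (rule inj_onI, rule ccontr)
    fix x y assume xy: "x \<in> topspace Y" "y \<in> topspace Y" "e x = e y" "x \<noteq> y"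
    have "to_nat_on \<B> ` {V \<in> \<B>. x \<in> V} = to_nat_on \<B> ` {V \<in> \<B>. y \<in> V}"
      using xy(3) r by (simp add: e_def inj_eq)
    then have eq: "{V \<in> \<B>. x \<in> V} = {V \<in> \<B>. y \<in> V}"
      by (subst (asm) inj_on_image_eq_iff[OF inj_on_to_nat_on[OF cB]]) auto
    obtain U W where "openin Y U" "openin Y W" "x \<in> U" "y \<in> W" "disjnt U W"
      using assms(2) xy unfolding Hausdorff_space_def by metis
    then show False using B[of U x] eq by (auto simp: disjnt_iff)
  qed
  define k where "k = inv_into (topspace Y) e"
  define Z where "Z = pullback_topology (e ` topspace Y) k Y"
  have ke: "k (e x) = x" if "x \<in> topspace Y" for x
    using inj that by (simp add: k_def)
  have tZ: "topspace Z = e ` topspace Y"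
    by (auto simp: Z_def topspace_pullback_topology ke)
  have "continuous_map Y Z e"
    unfolding Z_def
  proof (rule continuous_map_pullback')
    show "continuous_map Y Y (k \<circ> e)"
      by (rule continuous_map_eq[OF continuous_map_id]) (simp add: ke)
  qed auto
  moreover have "continuous_map Z Y k"
    using continuous_map_pullback[OF continuous_map_id, of "e ` topspace Y" k Y]
    by (simp add: Z_def)
  ultimately have "homeomorphic_maps Y Z e k"
    by (auto simp: homeomorphic_maps_def tZ ke)
  then show ?thesis
    unfolding homeomorphic_space_def by blast
qed

lemma factor_through_real:
  fixes Y :: "'c topology"
  assumes "tychonoff_space Y" "second_countable Y"
    and "continuous_map X Y h" "continuous_map Y W g"
    and "\<forall>x \<in> topspace X. f x = (g \<circ> h) x"
  shows "\<exists>(Z :: real topology) h g.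
           tychonoff_space Z \<and> second_countable Z \<and>
           continuous_map X Z h \<and> continuous_map Z W g \<and>
           (\<forall>x \<in> topspace X. f x = (g \<circ> h) x)"
proof -
  obtain Z :: "real topology" where hom: "Y homeomorphic_space Z"
    using second_countable_Hausdorff_real_copy[of Y] assms(1,2) unfolding tychonoff_space_def by auto
  then obtain e k where ek: "homeomorphic_maps Y Z e k"
    unfolding homeomorphic_space_def by blast
  have "tychonoff_space Z" "second_countable Z"
    using assms(1,2) homeomorphic_Hausdorff_space[OF hom]
      homeomorphic_completely_regular_space[OF hom] homeomorphic_space_second_countability[OF hom]
    unfolding tychonoff_space_def by auto
  moreover have "continuous_map X Z (e \<circ> h)" "continuous_map Z W (g \<circ> k)"
    using ek assms(3,4) by (auto simp: homeomorphic_maps_def intro: continuous_map_compose)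
  moreover have "\<forall>x \<in> topspace X. f x = ((g \<circ> k) \<circ> (e \<circ> h)) x"
    using ek assms(3,5) by (auto simp: homeomorphic_maps_def continuous_map_def Pi_iff)
  ultimately show ?thesis by blast
qed

end

theory Submission
  imports Defs
begin

text \<open>
All four assertions are equivalent to the existence of a certain filter \<open>F\<close> on \<open>\<nat>\<close>: it contains the
cofinite sets, it has no countable base, and nevertheless any \<open>\<omega>\<^sub>1\<close> of its members are refined by
countably many of its members.

A nonmetrizable factorizable space \<open>X\<close> yields such a filter
(\<open>nonmetrizable_factorizable_imp_filter\<close>).  Factorizability says that any \<open>\<omega>\<^sub>1\<close> cozero sets are unions
of sets from one countable open family (\<open>factorizable_generates_cozero\<close>).  By pigeonhole this
makes \<open>X\<close> separable and hereditarily Lindelof, and if \<open>X\<close> were first countable, it would even be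
metrizable (\<open>first_countable_factorizable_imp_metrizable\<close>).  So some point has uncountable
character, and the traces of its neighbourhoods on a countable dense set form the filter.

The filter can be thinned out to one of character exactly \<open>\<omega>\<^sub>2\<close> by a recursion of length \<open>\<omega>\<^sub>2\<close>
(\<open>filter_of_character_omega2\<close>).

Conversely, such a filter defines a topology on the Boolean group of finite subsets of \<open>\<nat>\<close>, the
neighbourhoods of zero being the subgroups of finite subsets of \<open>M\<close>, for \<open>M \<in> F\<close>.  As the group is
countable, any \<open>\<omega>\<^sub>1\<close> open sets use only \<open>\<omega>\<^sub>1\<close> members of \<open>F\<close>; these are refined by countably many, so
the open sets are already open in a coarser second-countable group topology of the same kind.  This
gives factorizability, and it passes to subspaces (\<open>factorizable_bit_topology\<close>).  The subspace of
zero and the singletons has zero as its only nonisolated point, and its character there, which is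
also its weight, is the character of \<open>F\<close>.  Because the group and the space are countable, they can
be copied into any infinite type.
\<close>

section \<open>Recursion and regularity at successor cardinals\<close>

text \<open>Transfinite recursion of length \<open>r\<^sup>+\<close>: at every stage only \<open>r\<close> many objects have been chosen, so it is
enough that each family of size at most \<open>r\<close> can be prolonged by one object.  It is used with
\<open>r = \<omega>\<close> to extract \<open>\<omega>\<^sub>1\<close>-sequences from a space, and with \<open>r = \<omega>\<^sub>1\<close> to build a filter of
character \<open>\<omega>\<^sub>2\<close>.\<close>
lemma cardSuc_sequence:
  assumes r: "Card_order r"
    and step: "\<And>A. A \<subseteq> S \<Longrightarrow> |A| \<le>o r \<Longrightarrow> \<exists>x\<in>S. P A x"
  obtains s where "\<And>a. a \<in> Field (cardSuc r) \<Longrightarrow> s a \<in> S"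
    and "\<And>a. a \<in> Field (cardSuc r) \<Longrightarrow> P (s ` underS (cardSuc r) a) (s a)"
proof -
  let ?R = "cardSuc r"
  have R: "Card_order ?R" by (rule cardSuc_Card_order[OF r])
  have small: "|underS ?R a| \<le>o r" if "a \<in> Field ?R" for a
    using card_of_underS[OF R that] cardSuc_ordLeq_ordLess[OF r card_of_Card_order] by blast
  have "wf (?R - Id)"
    using R by (simp add: card_order_on_def well_order_on_def)
  then have "\<exists>s. \<forall>a. a \<in> Field ?R \<longrightarrow> s a \<in> S \<and> P (s ` underS ?R a) (s a)"
  proof (rule dependent_wf_choice)
    fix f g :: "'a set \<Rightarrow> 'b" and a x
    assume "\<And>z. (z, a) \<in> ?R - Id \<Longrightarrow> f z = g z"
    then have "f ` underS ?R a = g ` underS ?R a"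
      by (intro image_cong) (auto simp: underS_def)
    then show "(a \<in> Field ?R \<longrightarrow> x \<in> S \<and> P (f ` underS ?R a) x) =
               (a \<in> Field ?R \<longrightarrow> x \<in> S \<and> P (g ` underS ?R a) x)" by simp
  next
    fix a f
    assume IH: "\<And>y. (y, a) \<in> ?R - Id \<Longrightarrow> y \<in> Field ?R \<longrightarrow> f y \<in> S \<and> P (f ` underS ?R y) (f y)"
    show "\<exists>x. a \<in> Field ?R \<longrightarrow> x \<in> S \<and> P (f ` underS ?R a) x"
    proof (cases "a \<in> Field ?R")
      case True
      have "f ` underS ?R a \<subseteq> S"
        using IH by (auto simp: underS_def Field_def)
      moreover have "|f ` underS ?R a| \<le>o r"
        using card_of_image small[OF True] ordLeq_transitive by blast
      ultimately show ?thesis using step by blast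
    qed auto
  qed
  then show thesis using that by metis
qed

lemma countable_iff_natLeq: "countable A \<longleftrightarrow> |A| \<le>o natLeq"
proof -
  have "countable A \<longleftrightarrow> |A| \<le>o |UNIV :: nat set|"
    unfolding countable_def by (simp add: card_of_ordLeq[symmetric])
  also have "\<dots> \<longleftrightarrow> |A| \<le>o natLeq"
    using card_of_nat ordLeq_ordIso_trans ordIso_symmetric by blast
  finally show ?thesis .
qed

lemma Card_order_omega1: "Card_order omega1"
  by (rule cardSuc_Card_order[OF natLeq_Card_order])

lemma infinite_omega1: "infinite (Field omega1)"
  using Cinfinite_cardSuc[OF natLeq_Cinfinite] by (simp add: cinfinite_def)

lemma Card_order_omega2: "Card_order omega2"
  by (rule cardSuc_Card_order[OF Card_order_omega1])

lemma infinite_omega2: "infinite (Field omega2)"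
  using Cinfinite_cardSuc Card_order_omega1 infinite_omega1 by (force simp: cinfinite_def)

lemma uncountable_omega1: "uncountable (Field omega1)"
proof
  assume "countable (Field omega1)"
  then have "|Field omega1| \<le>o natLeq" by (simp add: countable_iff_natLeq)
  then have "omega1 \<le>o natLeq"
    using card_of_Field_ordIso[OF Card_order_omega1] ordIso_symmetric ordIso_ordLeq_trans by blast
  then show False
    using cardSuc_greater[OF natLeq_Card_order] not_ordLess_ordLeq by blast
qed

lemma countable_imp_le_omega1: "countable A \<Longrightarrow> |A| \<le>o omega1"
  using cardSuc_ordLeq[OF natLeq_Card_order] ordLeq_transitive by (auto simp: countable_iff_natLeq)

lemma card_ge_omega2: "\<not> |A| \<le>o omega1 \<Longrightarrow> omega2 \<le>o |A|"
  by (metis Card_order_omega1 cardSuc_ordLess_ordLeq card_of_Card_order card_of_Well_order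
      card_order_on_well_order_on not_ordLeq_iff_ordLess)

text \<open>Regularity of successor cardinals.  Since \<open>r\<^sup>+\<close> is a limit, the bound can be expressed through the
indices strictly below \<open>a\<close>, which is the form in which the recursion above speaks of earlier stages.\<close>
lemma bounded_in_cardSuc:
  assumes r: "Card_order r" "infinite (Field r)"
    and B: "B \<subseteq> (\<Union>a\<in>Field (cardSuc r). s a)" "|B| \<le>o r"
  obtains a where "a \<in> Field (cardSuc r)" "B \<subseteq> \<Union>(s ` underS (cardSuc r) a)"
proof -
  let ?R = "cardSuc r"
  have R: "Card_order ?R" by (rule cardSuc_Card_order[OF r(1)])
  have inf: "infinite (Field ?R)"
    using Cinfinite_cardSuc r by (force simp: cinfinite_def)
  have "relChain ?R (\<lambda>a. \<Union>(s ` underS ?R a))"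
    unfolding relChain_def
  proof (intro allI impI)
    fix a b assume "(a, b) \<in> ?R"
    moreover have "trans ?R" "antisym ?R"
      using R by (auto simp: card_order_on_def well_order_on_def linear_order_on_def
          partial_order_on_def preorder_on_def)
    ultimately have "underS ?R a \<subseteq> underS ?R b"
      by (auto simp: underS_def dest: transD antisymD)
    then show "\<Union>(s ` underS ?R a) \<subseteq> \<Union>(s ` underS ?R b)" by blast
  qed
  moreover have "B \<subseteq> (\<Union>a\<in>Field ?R. \<Union>(s ` underS ?R a))"
  proof
    fix x assume "x \<in> B"
    then obtain a where a: "a \<in> Field ?R" "x \<in> s a" using B(1) by blast
    then obtain b where "b \<in> Field ?R" "a \<noteq> b" "(a, b) \<in> ?R"
      using infinite_Card_order_limit[OF R inf] by blast
    then show "x \<in> (\<Union>a\<in>Field ?R. \<Union>(s ` underS ?R a))"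
      using a by (auto simp: underS_def)
  qed
  ultimately obtain a where "a \<in> Field ?R" "B \<subseteq> \<Union>(s ` underS ?R a)"
    using cardSuc_UNION[OF r, of "\<lambda>a. \<Union>(s ` underS ?R a)" B] B(2) by blast
  then show thesis by (rule that)
qed

section \<open>Filters in which small subfamilies are countably refined\<close>
definition refines :: "'a set set \<Rightarrow> 'a set set \<Rightarrow> bool" where
  "refines \<C> \<A> \<longleftrightarrow> (\<forall>A\<in>\<A>. \<exists>C\<in>\<C>. C \<subseteq> A)"

text \<open>Improper filters are admitted: the full power set has the countable base \<open>{{}}\<close>, so properness is
a consequence of not being countably based.\<close>
definition free_filter :: "nat set set \<Rightarrow> bool" where
  "free_filter F \<longleftrightarrow>
     (\<forall>A\<in>F. \<forall>B. A \<subseteq> B \<longrightarrow> B \<in> F) \<and> (\<forall>A\<in>F. \<forall>B\<in>F. A \<inter> B \<in> F) \<and> (\<forall>k. - {k} \<in> F)"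

definition countably_refined :: "nat set set \<Rightarrow> bool" where
  "countably_refined F \<longleftrightarrow>
     (\<forall>\<A>\<subseteq>F. |\<A>| \<le>o omega1 \<longrightarrow> (\<exists>\<C>\<subseteq>F. countable \<C> \<and> refines \<C> \<A>))"

definition countably_based :: "nat set set \<Rightarrow> bool" where
  "countably_based F \<longleftrightarrow> (\<exists>\<C>\<subseteq>F. countable \<C> \<and> refines \<C> F)"

lemma refines_trans: "refines \<B> \<C> \<Longrightarrow> refines \<C> \<A> \<Longrightarrow> refines \<B> \<A>"
  unfolding refines_def by (meson subset_trans)

lemma refines_mono: "refines \<C> \<A> \<Longrightarrow> \<C> \<subseteq> \<C>' \<Longrightarrow> \<A>' \<subseteq> \<A> \<Longrightarrow> refines \<C>' \<A>'"
  unfolding refines_def by (meson subsetD)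

lemma free_filter_Inter:
  assumes "free_filter F" "finite \<G>" "\<G> \<subseteq> F"
  shows "\<Inter>\<G> \<in> F"
  using assms(2,3)
proof (induction)
  case empty
  show ?case using assms(1) unfolding free_filter_def by (metis Inter_empty top_greatest)
next
  case (insert x \<G>)
  then show ?case using assms(1) by (simp add: free_filter_def)
qed

lemma countable_filter_base:
  assumes F: "free_filter F" and C: "countable \<C>" "\<C> \<subseteq> F"
  obtains \<D> where "countable \<D>" "\<D> \<subseteq> F" "\<C> \<subseteq> \<D>" "\<And>k. - {k} \<in> \<D>"
    "\<And>A B. A \<in> \<D> \<Longrightarrow> B \<in> \<D> \<Longrightarrow> A \<inter> B \<in> \<D>"
proof
  let ?E = "\<C> \<union> range (\<lambda>k. - {k})"
  let ?D = "Inter ` {\<G>. finite \<G> \<and> \<G> \<subseteq> ?E}"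
  have E: "?E \<subseteq> F" using F C by (auto simp: free_filter_def)
  have "countable ?E" using C by auto
  then have "countable {\<G>. finite \<G> \<and> \<G> \<subseteq> ?E}"
    by (rule countable_Collect_finite_subset)
  then show "countable ?D" by (rule countable_image)
  show "?D \<subseteq> F"
  proof
    fix x assume "x \<in> ?D"
    then obtain \<G> where "finite \<G>" "\<G> \<subseteq> ?E" "x = \<Inter>\<G>" by (elim imageE CollectE conjE)
    then show "x \<in> F" using free_filter_Inter[OF F, of \<G>] E by (metis subset_trans)
  qed
  have "x \<in> ?D" if "x \<in> ?E" for x
    using that by (intro image_eqI[of _ _ "{x}"]) auto
  then show "\<C> \<subseteq> ?D" "\<And>k. - {k} \<in> ?D" by blast+
  show "A \<inter> B \<in> ?D" if AB: "A \<in> ?D" "B \<in> ?D" for A B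
  proof -
    obtain \<G> \<H> where "finite \<G>" "\<G> \<subseteq> ?E" "A = \<Inter>\<G>" "finite \<H>" "\<H> \<subseteq> ?E" "B = \<Inter>\<H>"
      using AB by (elim imageE CollectE conjE)
    then show ?thesis by (intro image_eqI[of _ _ "\<G> \<union> \<H>"]) auto
  qed
qed

lemma free_filter_upward_closure:
  assumes "\<And>A B. A \<in> \<D> \<Longrightarrow> B \<in> \<D> \<Longrightarrow> \<exists>C\<in>\<D>. C \<subseteq> A \<inter> B" "\<And>k. - {k} \<in> \<D>"
  shows "free_filter {A. \<exists>D\<in>\<D>. D \<subseteq> A}"
  unfolding free_filter_def
proof (intro conjI ballI allI impI)
  fix A B assume "A \<in> {A. \<exists>D\<in>\<D>. D \<subseteq> A}" "B \<in> {A. \<exists>D\<in>\<D>. D \<subseteq> A}"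
  then obtain D E where "D \<in> \<D>" "D \<subseteq> A" "E \<in> \<D>" "E \<subseteq> B" by blast
  moreover from this obtain C where "C \<in> \<D>" "C \<subseteq> D \<inter> E" using assms(1) by blast
  ultimately show "A \<inter> B \<in> {A. \<exists>D\<in>\<D>. D \<subseteq> A}" by blast
qed (use assms(2) in auto)

text \<open>The character is cut down to exactly \<open>\<omega>\<^sub>2\<close> by choosing countable subfamilies \<open>s a\<close> of \<open>F\<close> for
\<open>a < \<omega>\<^sub>2\<close>, each refining all earlier ones and containing a set that includes no earlier set.  Such
a choice is always possible: only \<open>\<omega>\<^sub>1\<close> many sets have been used so far, they are refined by
countably many members of \<open>F\<close>, and these do not form a base.  Any \<open>\<omega>\<^sub>1\<close> members of the filter \<open>G\<close>
generated in this way come from a bounded part of the construction by regularity of \<open>\<omega>\<^sub>2\<close>.  Hence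
the next stage refines them, and its new set shows that they do not form a base.\<close>
lemma filter_of_character_omega2:
  assumes F: "free_filter F" and cr: "countably_refined F" and nb: "\<not> countably_based F"
  obtains G where "free_filter G" "countably_refined G" "\<not> countably_based G"
    "\<exists>\<B>\<subseteq>G. |\<B>| \<le>o omega2 \<and> refines \<B> G"
    "\<And>\<B>. \<B> \<subseteq> G \<Longrightarrow> refines \<B> G \<Longrightarrow> omega2 \<le>o |\<B>|"
proof -
  define S where "S = {\<C>. \<C> \<subseteq> F \<and> countable \<C> \<and> (\<forall>k. - {k} \<in> \<C>) \<and>
    (\<forall>A\<in>\<C>. \<forall>B\<in>\<C>. A \<inter> B \<in> \<C>)}"
  define P :: "nat set set set \<Rightarrow> nat set set \<Rightarrow> bool"
    where "P = (\<lambda>\<A> \<C>. refines \<C> (\<Union>\<A>) \<and> (\<exists>A\<in>\<C>. \<forall>B\<in>\<Union>\<A>. \<not> B \<subseteq> A))"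
  have step: "\<exists>\<C>\<in>S. P \<A> \<C>" if "\<A> \<subseteq> S" "|\<A>| \<le>o omega1" for \<A>
  proof -
    have "|\<Union>(id ` \<A>)| \<le>o omega1"
    proof (rule card_of_UNION_ordLeq_infinite_Field[OF infinite_omega1 Card_order_omega1 that(2)])
      show "\<forall>\<C>\<in>\<A>. |id \<C>| \<le>o omega1"
        using that(1) countable_imp_le_omega1 by (auto simp: S_def)
    qed
    then have "|\<Union>\<A>| \<le>o omega1" by simp
    moreover have "\<Union>\<A> \<subseteq> F" using that(1) by (auto simp: S_def)
    ultimately obtain \<C> where C: "\<C> \<subseteq> F" "countable \<C>" "refines \<C> (\<Union>\<A>)"
      using cr unfolding countably_refined_def by meson
    then obtain A where A: "A \<in> F" "\<And>C. C \<in> \<C> \<Longrightarrow> \<not> C \<subseteq> A"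
      using nb by (auto simp: countably_based_def refines_def)
    obtain \<D> where D: "countable \<D>" "\<D> \<subseteq> F" "insert A \<C> \<subseteq> \<D>" "\<And>k. - {k} \<in> \<D>"
      "\<And>A B. A \<in> \<D> \<Longrightarrow> B \<in> \<D> \<Longrightarrow> A \<inter> B \<in> \<D>"
      using countable_filter_base[OF F, of "insert A \<C>"] C(1,2) A(1)
      by (metis countable_insert insert_subset)
    have "\<forall>B\<in>\<Union>\<A>. \<not> B \<subseteq> A"
      using A(2) C(3) unfolding refines_def by (meson subset_trans)
    then have "P \<A> \<D>"
      using D(3) refines_mono[OF C(3)] by (auto simp: P_def)
    moreover have "\<D> \<in> S" using D by (auto simp: S_def)
    ultimately show ?thesis by blast
  qed
  obtain s where sS: "\<And>a. a \<in> Field omega2 \<Longrightarrow> s a \<in> S"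
    and sP: "\<And>a. a \<in> Field omega2 \<Longrightarrow> P (s ` underS omega2 a) (s a)"
    using cardSuc_sequence[OF Card_order_omega1, of S P, OF step] by blast
  define \<D> where "\<D> = (\<Union>a\<in>Field omega2. s a)"
  define G where "G = {A. \<exists>D\<in>\<D>. D \<subseteq> A}"
  have bounded: "\<exists>a\<in>Field omega2. \<A> \<subseteq> \<Union>(s ` underS omega2 a)"
    if "\<A> \<subseteq> \<D>" "|\<A>| \<le>o omega1" for \<A>
    using bounded_in_cardSuc[OF Card_order_omega1 infinite_omega1 that(1)[unfolded \<D>_def] that(2)]
    by metis
  have small: "\<exists>a\<in>Field omega2. refines (\<Union>(s ` underS omega2 a)) \<A>"
    if "\<A> \<subseteq> G" "|\<A>| \<le>o omega1" for \<A>
  proof -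
    have "\<forall>A\<in>\<A>. \<exists>D. D \<in> \<D> \<and> D \<subseteq> A" using that(1) by (auto simp: G_def)
    then obtain d where d: "\<forall>A\<in>\<A>. d A \<in> \<D> \<and> d A \<subseteq> A" by (auto dest: bchoice)
    then have "d ` \<A> \<subseteq> \<D>" by blast
    moreover have "|d ` \<A>| \<le>o omega1"
      using card_of_image that(2) by (rule ordLeq_transitive)
    ultimately obtain a where "a \<in> Field omega2" "d ` \<A> \<subseteq> \<Union>(s ` underS omega2 a)"
      using bounded by meson
    moreover from this(2) have "refines (\<Union>(s ` underS omega2 a)) \<A>"
      using d unfolding refines_def by (meson image_subset_iff)
    ultimately show ?thesis by blast
  qed
  have DG: "\<D> \<subseteq> G" by (auto simp: G_def)
  have ne: "Field omega2 \<noteq> {}" using infinite_omega2 by auto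
  have "free_filter G"
    unfolding G_def
  proof (rule free_filter_upward_closure)
    fix A B assume "A \<in> \<D>" "B \<in> \<D>"
    moreover have "|{A, B}| \<le>o omega1" by (rule countable_imp_le_omega1) simp
    ultimately obtain a where a: "a \<in> Field omega2" "{A, B} \<subseteq> \<Union>(s ` underS omega2 a)"
      using bounded[of "{A, B}"] by blast
    then have "refines (s a) {A, B}"
      using sP[OF a(1)] unfolding P_def by (blast intro: refines_mono)
    then obtain A' B' where "A' \<in> s a" "B' \<in> s a" "A' \<subseteq> A" "B' \<subseteq> B"
      by (auto simp: refines_def)
    moreover from this have "A' \<inter> B' \<in> s a" using sS[OF a(1)] by (simp add: S_def)
    ultimately show "\<exists>C\<in>\<D>. C \<subseteq> A \<inter> B"
      using a(1) unfolding \<D>_def by (intro bexI[of _ "A' \<inter> B'"]) auto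
  next
    show "- {k} \<in> \<D>" for k using ne sS unfolding \<D>_def S_def by blast
  qed
  moreover have "countably_refined G"
    unfolding countably_refined_def
  proof (intro allI impI)
    fix \<A> assume "\<A> \<subseteq> G" "|\<A>| \<le>o omega1"
    then obtain a where a: "a \<in> Field omega2" "refines (\<Union>(s ` underS omega2 a)) \<A>"
      using small by blast
    then have "refines (s a) \<A>" using sP[OF a(1)] refines_trans by (auto simp: P_def)
    moreover have "s a \<subseteq> G" "countable (s a)" using a(1) DG sS[OF a(1)] by (auto simp: \<D>_def S_def)
    ultimately show "\<exists>\<C>\<subseteq>G. countable \<C> \<and> refines \<C> \<A>" by blast
  qed
  moreover have nosmall: "\<not> |\<B>| \<le>o omega1" if B: "\<B> \<subseteq> G" "refines \<B> G" for \<B>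
  proof
    assume "|\<B>| \<le>o omega1"
    then obtain a where a: "a \<in> Field omega2" "refines (\<Union>(s ` underS omega2 a)) \<B>"
      using small[OF B(1)] by meson
    moreover have "s a \<subseteq> G" using a(1) DG by (auto simp: \<D>_def)
    ultimately have "refines (\<Union>(s ` underS omega2 a)) (s a)"
      using refines_mono[OF refines_trans[OF a(2) B(2)] subset_refl] by simp
    then show False using sP[OF a(1)] by (auto simp: P_def refines_def)
  qed
  moreover have "|\<D>| \<le>o omega2"
    unfolding \<D>_def
  proof (rule card_of_UNION_ordLeq_infinite_Field[OF infinite_omega2 Card_order_omega2])
    show "|Field omega2| \<le>o omega2"
      using card_of_Field_ordIso[OF Card_order_omega2] ordIso_imp_ordLeq by blast
    show "\<forall>a\<in>Field omega2. |s a| \<le>o omega2"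
    proof
      fix a assume "a \<in> Field omega2"
      then have "countable (s a)" using sS by (simp add: S_def)
      then show "|s a| \<le>o omega2"
        using countable_imp_le_omega1 cardSuc_ordLeq[OF Card_order_omega1] ordLeq_transitive by blast
    qed
  qed
  then have "\<exists>\<B>\<subseteq>G. |\<B>| \<le>o omega2 \<and> refines \<B> G"
    using DG by (auto simp: G_def refines_def)
  moreover have "\<not> countably_based G"
    using nosmall countable_imp_le_omega1 by (auto simp: countably_based_def)
  moreover have "omega2 \<le>o |\<B>|" if "\<B> \<subseteq> G" "refines \<B> G" for \<B>
    using nosmall[OF that] by (rule card_ge_omega2)
  ultimately show thesis using that by blast
qed

section \<open>From a factorizable space to a filter\<close>
definition cozero :: "'a topology \<Rightarrow> 'a set \<Rightarrow> bool" where
  "cozero X U \<longleftrightarrow> (\<exists>f. continuous_map X euclideanreal f \<and> U = {x \<in> topspace X. f x \<noteq> 0})"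

lemma openin_nonzero:
  assumes "continuous_map X euclideanreal f"
  shows "openin X {x \<in> topspace X. f x \<noteq> 0}"
proof -
  have "openin euclideanreal (- {0})" by auto
  from openin_continuous_map_preimage[OF assms this] show ?thesis by simp
qed

lemma cozero_imp_openin: "cozero X U \<Longrightarrow> openin X U"
  by (auto simp: cozero_def openin_nonzero)

lemma cozero_witnesses:
  assumes "\<And>W. W \<in> \<W> \<Longrightarrow> cozero X W"
  obtains \<phi> where "\<And>W. W \<in> \<W> \<Longrightarrow> continuous_map X euclideanreal (\<phi> W)"
    "\<And>W x. W \<in> \<W> \<Longrightarrow> x \<in> topspace X \<Longrightarrow> \<phi> W x \<noteq> 0 \<longleftrightarrow> x \<in> W"
proof -
  have "\<forall>W\<in>\<W>. \<exists>f. continuous_map X euclideanreal f \<and> W = {x \<in> topspace X. f x \<noteq> 0}"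
    using assms by (auto simp: cozero_def)
  from bchoice[OF this] obtain \<phi> where
    "\<forall>W\<in>\<W>. continuous_map X euclideanreal (\<phi> W) \<and> W = {x \<in> topspace X. \<phi> W x \<noteq> 0}" ..
  then show thesis by (intro that[of \<phi>]) auto
qed

lemma cozero_neighbourhood:
  assumes "completely_regular_space X" "openin X U" "x \<in> U"
  obtains W where "cozero X W" "x \<in> W" "W \<subseteq> U"
proof -
  obtain f where f: "continuous_map X euclideanreal f" "f x = 0" "f ` (topspace X - U) \<subseteq> {1}"
    using assms unfolding completely_regular_space_alt' by blast
  have "continuous_map X euclideanreal (\<lambda>x. 1 - f x)"
    by (intro continuous_map_diff f(1)) simp
  then have "cozero X {x \<in> topspace X. 1 - f x \<noteq> 0}" by (auto simp: cozero_def)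
  moreover have "x \<in> {x \<in> topspace X. 1 - f x \<noteq> 0}"
    using f(2) assms openin_subset by fastforce
  moreover have "{x \<in> topspace X. 1 - f x \<noteq> 0} \<subseteq> U" using f(3) by auto
  ultimately show thesis by (rule that)
qed

text \<open>The only way in which factorizability is used below.  The functions defining the cozero sets are
combined into one map to \<open>\<real>\<^bsup>\<omega>\<^sub>1\<^esup>\<close>; the preimages of a countable base of the second-countable
factor then generate all the given sets.\<close>
lemma factorizable_generates_cozero:
  assumes X: "R_omega1_factorizable X" and W: "\<forall>W\<in>\<W>. cozero X W" "|\<W>| \<le>o omega1"
  shows "\<exists>\<C>. countable \<C> \<and> (\<forall>C\<in>\<C>. openin X C) \<and>
    (\<forall>W\<in>\<W>. \<forall>x\<in>W. \<exists>C\<in>\<C>. x \<in> C \<and> C \<subseteq> W)"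
proof (cases "\<W> = {}")
  case True
  then show ?thesis by (intro exI[of _ "{}"]) auto
next
  case False
  have "|\<W>| \<le>o |Field omega1|"
    by (rule ordLeq_ordIso_trans[OF W(2) ordIso_symmetric[OF card_of_Field_ordIso[OF Card_order_omega1]]])
  from iffD2[OF card_of_ordLeq2[OF False] this]
  obtain e where e: "e ` Field omega1 = \<W>" ..
  obtain \<phi> where \<phi>: "\<And>W. W \<in> \<W> \<Longrightarrow> continuous_map X euclideanreal (\<phi> W)"
    and \<phi>_iff: "\<And>W x. W \<in> \<W> \<Longrightarrow> x \<in> topspace X \<Longrightarrow> \<phi> W x \<noteq> 0 \<longleftrightarrow> x \<in> W"
    using cozero_witnesses[of \<W> X] W(1) by blast
  define f where "f x = (\<lambda>a\<in>Field omega1. \<phi> (e a) x)" for x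
  have "continuous_map X R_pow_omega1 f"
    unfolding continuous_map_componentwise
    using \<phi> e by (auto simp: f_def)
  then obtain Y :: "real topology" and h g where Y: "second_countable Y"
    and h: "continuous_map X Y h" and g: "continuous_map Y R_pow_omega1 g"
    and fgh: "\<And>x. x \<in> topspace X \<Longrightarrow> f x = g (h x)"
    using X unfolding R_omega1_factorizable_def by fastforce
  obtain \<B> where \<B>: "countable \<B>" "\<And>V. V \<in> \<B> \<Longrightarrow> openin Y V"
    "\<And>U x. openin Y U \<Longrightarrow> x \<in> U \<Longrightarrow> \<exists>V\<in>\<B>. x \<in> V \<and> V \<subseteq> U"
    using Y unfolding second_countable_def by metis
  let ?C = "(\<lambda>V. {x \<in> topspace X. h x \<in> V}) ` \<B>"
  show ?thesis
  proof (intro exI[of _ ?C] conjI ballI)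
    show "countable ?C" using \<B>(1) by simp
    show "openin X C" if "C \<in> ?C" for C
      using that \<B>(2) openin_continuous_map_preimage[OF h] by auto
    fix W x assume W: "W \<in> \<W>" and x: "x \<in> W"
    then obtain a where a: "a \<in> Field omega1" "W = e a" using e by blast
    have xX: "x \<in> topspace X"
      using x W assms(2) cozero_imp_openin openin_subset by blast
    have ga: "g (h z) a = \<phi> W z" if "z \<in> topspace X" for z
      using fgh[OF that] a by (simp add: f_def fun_eq_iff) metis
    have "continuous_map Y euclideanreal (\<lambda>y. g y a)"
      using g a(1) by (simp add: continuous_map_componentwise)
    then have "openin Y {y \<in> topspace Y. g y a \<noteq> 0}" by (rule openin_nonzero)
    moreover have "h x \<in> {y \<in> topspace Y. g y a \<noteq> 0}"
      using ga[OF xX] \<phi>_iff[OF W xX] x xX h by (auto simp: continuous_map_def)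
    ultimately obtain V where V: "V \<in> \<B>" "h x \<in> V" "V \<subseteq> {y \<in> topspace Y. g y a \<noteq> 0}"
      using \<B>(3) by meson
    have "{x \<in> topspace X. h x \<in> V} \<subseteq> W"
      using V(3) ga \<phi>_iff[OF W] by auto
    then show "\<exists>C\<in>?C. x \<in> C \<and> C \<subseteq> W" using V xX by auto
  qed
qed

text \<open>The pigeonhole form of the preceding lemma: shrinking each \<open>U a\<close> around \<open>x a\<close> to one of countably
many open sets must produce the same set for two indices.  It excludes both left separated and
right separated sequences of length \<open>\<omega>\<^sub>1\<close>, whence the next two lemmas.\<close>
lemma factorizable_omega1_collision:
  assumes X: "R_omega1_factorizable X"
    and U: "\<And>a. a \<in> Field omega1 \<Longrightarrow> cozero X (U a)" "\<And>a. a \<in> Field omega1 \<Longrightarrow> x a \<in> U a"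
  shows "\<exists>a\<in>Field omega1. \<exists>b\<in>underS omega1 a. x a \<in> U b \<and> x b \<in> U a"
proof -
  have card: "|U ` Field omega1| \<le>o omega1"
    by (rule ordLeq_ordIso_trans[OF card_of_image card_of_Field_ordIso[OF Card_order_omega1]])
  have coz: "\<forall>W\<in>U ` Field omega1. cozero X W" using U(1) by auto
  from factorizable_generates_cozero[OF X coz card]
  obtain \<C> where \<C>: "countable \<C>" "\<forall>C\<in>\<C>. openin X C"
    "\<forall>W\<in>U ` Field omega1. \<forall>x\<in>W. \<exists>C\<in>\<C>. x \<in> C \<and> C \<subseteq> W"
    by (elim exE conjE)
  have "\<forall>a\<in>Field omega1. \<exists>C. C \<in> \<C> \<and> x a \<in> C \<and> C \<subseteq> U a"
    using \<C>(3) U(2) by blast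
  then obtain c where c: "\<And>a. a \<in> Field omega1 \<Longrightarrow> c a \<in> \<C> \<and> x a \<in> c a \<and> c a \<subseteq> U a" by metis
  have "c ` Field omega1 \<subseteq> \<C>" using c by blast
  then have "countable (c ` Field omega1)" using \<C>(1) countable_subset by blast
  then have "\<not> inj_on c (Field omega1)"
    using uncountable_omega1 countable_image_inj_eq by blast
  then obtain a b where ab: "a \<in> Field omega1" "b \<in> Field omega1" "a \<noteq> b" "c a = c b"
    by (auto simp: inj_on_def)
  have "x a \<in> U b" "x b \<in> U a" using c[OF ab(1)] c[OF ab(2)] ab(4) by auto
  moreover have "(a, b) \<in> omega1 \<or> (b, a) \<in> omega1"
    using Card_order_omega1 ab(1-3)
    by (auto simp: card_order_on_def well_order_on_def linear_order_on_def total_on_def)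
  ultimately show ?thesis using ab(1-3) unfolding underS_def by blast
qed

text \<open>Otherwise there is a right separated \<open>\<omega>\<^sub>1\<close>-sequence: each new point avoids the neighbourhoods of
the earlier ones.  The sequence consists of pairs of a point and a cozero neighbourhood.\<close>
lemma factorizable_hereditarily_Lindelof:
  assumes cr: "completely_regular_space X" and X: "R_omega1_factorizable X"
    and V: "\<And>V. V \<in> \<V> \<Longrightarrow> openin X V"
  shows "\<exists>\<D>\<subseteq>\<V>. countable \<D> \<and> \<Union>\<D> = \<Union>\<V>"
proof (rule ccontr)
  assume no: "\<not> ?thesis"
  define S where "S = {p. cozero X (snd p) \<and> fst p \<in> snd p \<and> (\<exists>V\<in>\<V>. snd p \<subseteq> V)}"
  have "\<exists>p\<in>S. fst p \<notin> \<Union>(snd ` A)" if A: "A \<subseteq> S" "|A| \<le>o natLeq" for A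
  proof -
    have "\<forall>p\<in>A. \<exists>V. V \<in> \<V> \<and> snd p \<subseteq> V" using A(1) by (auto simp: S_def)
    then obtain v where v: "\<And>p. p \<in> A \<Longrightarrow> v p \<in> \<V> \<and> snd p \<subseteq> v p" by metis
    have "countable A" using A(2) by (simp add: countable_iff_natLeq)
    then have "v ` A \<subseteq> \<V> \<and> countable (v ` A)" using v by auto
    then have "\<Union>(v ` A) \<noteq> \<Union>\<V>" using no by metis
    moreover have "\<Union>(v ` A) \<subseteq> \<Union>\<V>" using v by blast
    ultimately obtain x V0 where x: "V0 \<in> \<V>" "x \<in> V0" "x \<notin> \<Union>(v ` A)" by blast
    obtain W where "cozero X W" "x \<in> W" "W \<subseteq> V0"
      using cozero_neighbourhood[OF cr V[OF x(1)] x(2)] .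
    then have "(x, W) \<in> S" using x by (auto simp: S_def)
    moreover have "x \<notin> \<Union>(snd ` A)" using x(3) v by blast
    ultimately show ?thesis by force
  qed
  from cardSuc_sequence[OF natLeq_Card_order, of S "\<lambda>A p. fst p \<notin> \<Union>(snd ` A)", OF this]
  obtain s where s: "\<And>a. a \<in> Field omega1 \<Longrightarrow> s a \<in> S"
    "\<And>a. a \<in> Field omega1 \<Longrightarrow> fst (s a) \<notin> \<Union>(snd ` s ` underS omega1 a)" by metis
  have "\<exists>a\<in>Field omega1. \<exists>b\<in>underS omega1 a. fst (s a) \<in> snd (s b) \<and> fst (s b) \<in> snd (s a)"
    using s(1) by (intro factorizable_omega1_collision[OF X]) (auto simp: S_def)
  then show False using s(2) by blast
qed

text \<open>Otherwise there is a left separated \<open>\<omega>\<^sub>1\<close>-sequence: each new point has a neighbourhood that misses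
the earlier points.\<close>
lemma factorizable_separable:
  assumes cr: "completely_regular_space X" and X: "R_omega1_factorizable X"
  shows "separable_space X"
proof (rule ccontr)
  assume no: "\<not> ?thesis"
  define S where "S = {p. cozero X (snd p) \<and> fst p \<in> snd p}"
  have "\<exists>p\<in>S. snd p \<inter> fst ` A = {}" if A: "A \<subseteq> S" "|A| \<le>o natLeq" for A
  proof -
    have "countable (fst ` A)" using A(2) countable_iff_natLeq countable_image by metis
    moreover have sub: "fst ` A \<subseteq> topspace X" using A(1) by (auto simp: S_def cozero_def)
    ultimately have "X closure_of (fst ` A) \<noteq> topspace X"
      using no by (auto simp: separable_space_def)
    then obtain x where x: "x \<in> topspace X" "x \<notin> X closure_of (fst ` A)"
      using closure_of_subset_topspace by fastforce
    then obtain V where V: "openin X V" "x \<in> V" "V \<inter> fst ` A = {}"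
      by (auto simp: in_closure_of)
    obtain W where "cozero X W" "x \<in> W" "W \<subseteq> V"
      using cozero_neighbourhood[OF cr V(1,2)] .
    then show ?thesis using V(3) by (intro bexI[of _ "(x, W)"]) (auto simp: S_def)
  qed
  from cardSuc_sequence[OF natLeq_Card_order, of S "\<lambda>A p. snd p \<inter> fst ` A = {}", OF this]
  obtain s where s: "\<And>a. a \<in> Field omega1 \<Longrightarrow> s a \<in> S"
    "\<And>a. a \<in> Field omega1 \<Longrightarrow> snd (s a) \<inter> fst ` s ` underS omega1 a = {}" by metis
  have "\<exists>a\<in>Field omega1. \<exists>b\<in>underS omega1 a. fst (s a) \<in> snd (s b) \<and> fst (s b) \<in> snd (s a)"
    using s(1) by (intro factorizable_omega1_collision[OF X]) (auto simp: S_def)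
  then show False using s(2) by blast
qed

text \<open>Urysohn's argument: the functions defining the base embed \<open>X\<close> into a countable power of \<open>\<real>\<close>.\<close>
lemma countable_cozero_base_imp_metrizable:
  assumes H: "Hausdorff_space X" and B: "countable \<B>" "is_base \<B> X"
    and coz: "\<And>B. B \<in> \<B> \<Longrightarrow> cozero X B"
  shows "metrizable_space X"
proof -
  obtain \<phi> where \<phi>: "\<And>B. B \<in> \<B> \<Longrightarrow> continuous_map X euclideanreal (\<phi> B)"
    and \<phi>_iff: "\<And>B x. B \<in> \<B> \<Longrightarrow> x \<in> topspace X \<Longrightarrow> \<phi> B x \<noteq> 0 \<longleftrightarrow> x \<in> B"
    using cozero_witnesses[of \<B> X] coz by blast
  define f where "f x = (\<lambda>B\<in>\<B>. \<phi> B x)" for x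
  let ?P = "product_topology (\<lambda>_. euclideanreal) \<B>"
  let ?Z = "subtopology ?P (f ` topspace X)"
  have cont: "continuous_map X ?P f"
    unfolding continuous_map_componentwise using \<phi> by (auto simp: f_def)
  then have tZ: "topspace ?Z = f ` topspace X"
    using continuous_map_image_subset_topspace by fastforce
  have inj: "inj_on f (topspace X)"
  proof (rule inj_onI, rule ccontr)
    fix x y assume xy: "x \<in> topspace X" "y \<in> topspace X" "f x = f y" "x \<noteq> y"
    obtain U where U: "openin X U" "x \<in> U" "y \<notin> U"
      using H xy unfolding Hausdorff_space_def disjnt_iff by metis
    then obtain B where B': "B \<in> \<B>" "x \<in> B" "y \<notin> B" using B(2) unfolding is_base_def by blast
    have "\<phi> B x = \<phi> B y" using fun_cong[OF xy(3), of B] B'(1) by (simp add: f_def)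
    then show False using \<phi>_iff B' xy(1,2) by metis
  qed
  have "open_map X ?Z f"
    unfolding open_map_def
  proof (intro allI impI)
    fix U assume U: "openin X U"
    let ?G = "\<lambda>B. {z \<in> topspace ?P. z B \<noteq> 0}"
    let ?O = "\<Union>B\<in>{B\<in>\<B>. B \<subseteq> U}. ?G B"
    have "openin ?P (?G B)" if "B \<in> \<B>" for B
      using that by (intro openin_nonzero continuous_map_product_projection)
    then have "openin ?P ?O" by (intro openin_Union) auto
    moreover have "f ` U = ?O \<inter> f ` topspace X"
    proof (intro equalityI subsetI)
      fix z assume "z \<in> f ` U"
      then obtain x where x: "x \<in> U" "z = f x" by blast
      have xX: "x \<in> topspace X" using x U openin_subset by blast
      obtain B where B': "B \<in> \<B>" "x \<in> B" "B \<subseteq> U" using B(2) x U unfolding is_base_def by blast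
      then have "f x B \<noteq> 0" using \<phi>_iff xX by (simp add: f_def)
      then show "z \<in> ?O \<inter> f ` topspace X"
        using x xX B' continuous_map_image_subset_topspace[OF cont] by blast
    next
      fix z assume "z \<in> ?O \<inter> f ` topspace X"
      then obtain x B where "x \<in> topspace X" "z = f x" "B \<in> \<B>" "B \<subseteq> U" "z B \<noteq> 0" by blast
      then show "z \<in> f ` U" using \<phi>_iff by (auto simp: f_def)
    qed
    ultimately show "openin ?Z (f ` U)" by (auto simp: openin_subtopology)
  qed
  then have "homeomorphic_map X ?Z f"
    using cont inj tZ by (intro bijective_open_imp_homeomorphic_map)
      (auto simp: continuous_map_in_subtopology)
  then have "X homeomorphic_space ?Z" using homeomorphic_map_imp_homeomorphic_space by blast
  moreover have "metrizable_space ?P"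
    using B(1) unfolding metrizable_space_product_topology by (auto simp: metrizable_space_euclidean)
  ultimately show ?thesis
    using homeomorphic_metrizable_space metrizable_space_subtopology by blast
qed


text \<open>Let \<open>K x\<close> be countable local bases of cozero sets.  If \<open>X\<close> is not metrizable, no countable
union of them is a base, and recursion yields points \<open>s a\<close>, \<open>a < \<omega>\<^sub>1\<close>, at which the sets in
\<open>K (s b)\<close>, \<open>b < a\<close>, fail to contain a local base.  Let \<open>\<W>\<close> be the union of all \<open>K (s a)\<close>, and let the countable family \<open>\<C>\<close> generate it.  By
the Lindelof property, for each \<open>C \<in> \<C>\<close> the union of the members of \<open>\<W>\<close> inside \<open>C\<close> is already a
countable union, and the countably many sets occurring in these unions appear before some stage
\<open>a\<close>.  Near \<open>s a\<close> one can therefore pass from any open \<open>U\<close> to some \<open>W \<in> K (s a)\<close>, then to \<open>C \<in> \<C>\<close>,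
and then to a set from an earlier \<open>K (s b)\<close>, contrary to the choice of \<open>s a\<close>.\<close>
lemma first_countable_factorizable_imp_metrizable:
  assumes X: "tychonoff_space X" "R_omega1_factorizable X" and fc: "first_countable X"
  shows "metrizable_space X"
proof (rule ccontr)
  assume nm: "\<not> ?thesis"
  have cr: "completely_regular_space X" and H: "Hausdorff_space X"
    using X(1) by (auto simp: tychonoff_space_def)
  have "\<exists>\<K>. countable \<K> \<and> (\<forall>W\<in>\<K>. cozero X W) \<and>
      (\<forall>U. openin X U \<and> x \<in> U \<longrightarrow> (\<exists>W\<in>\<K>. x \<in> W \<and> W \<subseteq> U))" if x: "x \<in> topspace X" for x
  proof -
    obtain \<B> where \<B>: "countable \<B>" "\<And>V. V \<in> \<B> \<Longrightarrow> openin X V"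
      "\<And>U. openin X U \<Longrightarrow> x \<in> U \<Longrightarrow> \<exists>V\<in>\<B>. x \<in> V \<and> V \<subseteq> U"
      using fc x unfolding first_countable_def by metis
    have "\<forall>V\<in>{V\<in>\<B>. x \<in> V}. \<exists>W. cozero X W \<and> x \<in> W \<and> W \<subseteq> V"
      using \<B>(2) cozero_neighbourhood[OF cr] by (metis mem_Collect_eq)
    then obtain w where w: "\<And>V. V \<in> \<B> \<Longrightarrow> x \<in> V \<Longrightarrow> cozero X (w V) \<and> x \<in> w V \<and> w V \<subseteq> V"
      by (metis (mono_tags, lifting) mem_Collect_eq)
    show ?thesis
    proof (intro exI[of _ "w ` {V\<in>\<B>. x \<in> V}"] conjI ballI allI impI)
      show "countable (w ` {V\<in>\<B>. x \<in> V})" using \<B>(1) by (simp add: countable_Collect)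
      show "cozero X W" if "W \<in> w ` {V\<in>\<B>. x \<in> V}" for W using that w by blast
      fix U assume "openin X U \<and> x \<in> U"
      then obtain V where "V \<in> \<B>" "x \<in> V" "V \<subseteq> U" using \<B>(3) by blast
      then show "\<exists>W\<in>w ` {V\<in>\<B>. x \<in> V}. x \<in> W \<and> W \<subseteq> U"
        using w by (intro bexI[of _ "w V"]) auto
    qed
  qed
  then obtain K where K: "\<And>x. x \<in> topspace X \<Longrightarrow> countable (K x)"
    "\<And>x W. x \<in> topspace X \<Longrightarrow> W \<in> K x \<Longrightarrow> cozero X W"
    "\<And>x U. x \<in> topspace X \<Longrightarrow> openin X U \<Longrightarrow> x \<in> U \<Longrightarrow> \<exists>W\<in>K x. x \<in> W \<and> W \<subseteq> U"
    by metis
  define P where "P A x \<longleftrightarrow> (\<exists>U. openin X U \<and> x \<in> U \<and> \<not> (\<exists>B\<in>\<Union>(K ` A). x \<in> B \<and> B \<subseteq> U))" for A x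
  have "\<exists>x\<in>topspace X. P A x" if A: "A \<subseteq> topspace X" "|A| \<le>o natLeq" for A
  proof (rule ccontr)
    assume no: "\<not> ?thesis"
    have "is_base (\<Union>(K ` A)) X"
      unfolding is_base_def
    proof (intro conjI ballI allI impI)
      fix V assume "V \<in> \<Union>(K ` A)"
      then show "openin X V" using K(2) A(1) cozero_imp_openin by blast
    next
      fix U x assume "openin X U \<and> x \<in> U"
      moreover from this have "x \<in> topspace X" using openin_subset by blast
      ultimately show "\<exists>V\<in>\<Union>(K ` A). x \<in> V \<and> V \<subseteq> U" using no unfolding P_def by blast
    qed
    moreover have "countable (\<Union>(K ` A))"
      using A K(1) by (intro countable_UN) (auto simp: countable_iff_natLeq[symmetric])
    moreover have "cozero X B" if "B \<in> \<Union>(K ` A)" for B using that K(2) A(1) by blast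
    ultimately show False using countable_cozero_base_imp_metrizable[OF H] nm by blast
  qed
  from cardSuc_sequence[OF natLeq_Card_order, of "topspace X" P, OF this]
  obtain s where s: "\<And>a. a \<in> Field omega1 \<Longrightarrow> s a \<in> topspace X"
    "\<And>a. a \<in> Field omega1 \<Longrightarrow> P (s ` underS omega1 a) (s a)" by metis
  define \<W> where "\<W> = (\<Union>a\<in>Field omega1. K (s a))"
  have card: "|\<W>| \<le>o omega1"
    unfolding \<W>_def
  proof (rule card_of_UNION_ordLeq_infinite_Field[OF infinite_omega1 Card_order_omega1])
    show "|Field omega1| \<le>o omega1"
      by (rule ordIso_imp_ordLeq[OF card_of_Field_ordIso[OF Card_order_omega1]])
    show "\<forall>a\<in>Field omega1. |K (s a)| \<le>o omega1"
      using s(1) K(1) countable_imp_le_omega1 by blast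
  qed
  have Wcoz: "\<forall>W\<in>\<W>. cozero X W"
    using s(1) K(2) unfolding \<W>_def by blast
  from factorizable_generates_cozero[OF X(2) Wcoz card]
  obtain \<C> where \<C>: "countable \<C>" "\<forall>C\<in>\<C>. openin X C"
    "\<forall>W\<in>\<W>. \<forall>x\<in>W. \<exists>C\<in>\<C>. x \<in> C \<and> C \<subseteq> W"
    by (elim exE conjE)
  have "\<exists>\<D>\<subseteq>{W\<in>\<W>. W \<subseteq> C}. countable \<D> \<and> \<Union>\<D> = \<Union>{W\<in>\<W>. W \<subseteq> C}" for C
    using Wcoz cozero_imp_openin by (intro factorizable_hereditarily_Lindelof[OF cr X(2)]) auto
  then have "\<forall>C. \<exists>\<D>. \<D> \<subseteq> {W\<in>\<W>. W \<subseteq> C} \<and> countable \<D> \<and> \<Union>\<D> = \<Union>{W\<in>\<W>. W \<subseteq> C}" by blast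
  from choice[OF this] obtain D where
    "\<forall>C. D C \<subseteq> {W\<in>\<W>. W \<subseteq> C} \<and> countable (D C) \<and> \<Union>(D C) = \<Union>{W\<in>\<W>. W \<subseteq> C}" ..
  then have D: "D C \<subseteq> {W\<in>\<W>. W \<subseteq> C}" "countable (D C)" "\<Union>(D C) = \<Union>{W\<in>\<W>. W \<subseteq> C}" for C
    by simp_all
  have "(\<Union>C\<in>\<C>. D C) \<subseteq> (\<Union>a\<in>Field omega1. K (s a))" using D(1) unfolding \<W>_def by blast
  moreover have "|\<Union>C\<in>\<C>. D C| \<le>o natLeq"
    using \<C>(1) D(2) by (simp add: countable_iff_natLeq[symmetric])
  moreover have "infinite (Field natLeq)" by (simp add: Field_natLeq)
  ultimately obtain a where a: "a \<in> Field omega1"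
    and sub: "(\<Union>C\<in>\<C>. D C) \<subseteq> \<Union>((\<lambda>a. K (s a)) ` underS omega1 a)"
    by (elim bounded_in_cardSuc[OF natLeq_Card_order, rotated])
  obtain U where U: "openin X U" "s a \<in> U"
    "\<not> (\<exists>B\<in>\<Union>(K ` s ` underS omega1 a). s a \<in> B \<and> B \<subseteq> U)"
    using s(2)[OF a] unfolding P_def by (elim exE conjE)
  obtain W where W: "W \<in> K (s a)" "s a \<in> W" "W \<subseteq> U" using K(3)[OF s(1)[OF a] U(1,2)] by blast
  then have "W \<in> \<W>" using a by (auto simp: \<W>_def)
  then obtain C where C: "C \<in> \<C>" "s a \<in> C" "C \<subseteq> W" using \<C>(3) W(2) by blast
  have "openin X C" using \<C>(2) C(1) by blast
  then obtain W' where "W' \<in> K (s a)" "s a \<in> W'" "W' \<subseteq> C"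
    using K(3)[OF s(1)[OF a] _ C(2)] by blast
  then have "s a \<in> \<Union>{W\<in>\<W>. W \<subseteq> C}" using a by (auto simp: \<W>_def)
  then obtain B where B: "B \<in> D C" "s a \<in> B" using D(3)[of C] by blast
  then have "B \<subseteq> U" using D(1)[of C] C(3) W(3) by blast
  moreover have "B \<in> \<Union>(K ` s ` underS omega1 a)" using B(1) C(1) sub by auto
  ultimately show False using U(3) B(2) by blast
qed

text \<open>There is a point \<open>p\<close> of uncountable character and a countable dense set \<open>S\<close>.  The filter consists of
the traces on \<open>S - {p}\<close> of the neighbourhoods of \<open>p\<close>, with \<open>S - {p}\<close> enumerated by \<open>d\<close>.  Passing to a
dense set does not lower the character at \<open>p\<close>, because in a regular space a neighbourhood is
controlled by the closure of its trace.\<close>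
lemma nonmetrizable_factorizable_imp_filter:
  assumes X: "tychonoff_space X" "R_omega1_factorizable X" and nm: "\<not> metrizable_space X"
  obtains F where "free_filter F" "countably_refined F" "\<not> countably_based F"
proof -
  have cr: "completely_regular_space X" and H: "Hausdorff_space X"
    using X(1) by (auto simp: tychonoff_space_def)
  have "\<not> first_countable X"
    using first_countable_factorizable_imp_metrizable[OF X] nm by blast
  then obtain p where p: "p \<in> topspace X"
    and nolocal: "\<And>\<B>. countable \<B> \<Longrightarrow> (\<And>V. V \<in> \<B> \<Longrightarrow> openin X V) \<Longrightarrow>
       \<exists>U. openin X U \<and> p \<in> U \<and> \<not> (\<exists>V\<in>\<B>. p \<in> V \<and> V \<subseteq> U)"
    unfolding first_countable_def by metis
  obtain S where S: "countable S" "S \<subseteq> topspace X" "X closure_of S = topspace X"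
    using factorizable_separable[OF cr X(2)] by (auto simp: separable_space_def)
  have inf: "infinite (S - {p})"
  proof
    assume "finite (S - {p})"
    then have fin: "finite S" by simp
    then have "closedin X S" using S(2) H by (simp add: closedin_Hausdorff_finite)
    then have "topspace X = S" using S(3) closure_of_closedin by metis
    then have "closedin X (topspace X - {p})"
      using fin H by (intro closedin_Hausdorff_finite) auto
    then have "openin X {p}" using p by (simp add: openin_closedin_eq)
    then show False using nolocal[of "{{p}}"] by auto
  qed
  define d where "d = from_nat_into (S - {p})"
  have bij: "bij_betw d UNIV (S - {p})"
    unfolding d_def using S(1) inf by (intro bij_betw_from_nat_into) auto
  define F where "F = {M. \<exists>U. openin X U \<and> p \<in> U \<and> d -` U \<subseteq> M}"
  have dS: "d n \<in> S" "d n \<noteq> p" "d n \<in> topspace X" for n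
    using bij S(2) by (auto simp: bij_betw_def)
  have "free_filter F"
    unfolding free_filter_def
  proof (intro conjI ballI allI impI)
    fix A B assume "A \<in> F" "A \<subseteq> B" then show "B \<in> F" unfolding F_def by blast
  next
    fix A B assume "A \<in> F" "B \<in> F"
    then obtain U V where "openin X U" "p \<in> U" "d -` U \<subseteq> A" "openin X V" "p \<in> V" "d -` V \<subseteq> B"
      unfolding F_def by blast
    then have "openin X (U \<inter> V)" "p \<in> U \<inter> V" "d -` (U \<inter> V) \<subseteq> A \<inter> B" by auto
    then show "A \<inter> B \<in> F" unfolding F_def by blast
  next
    fix k
    have "openin X (topspace X - {d k})"
      using H dS(3) by (simp add: closedin_Hausdorff_singleton openin_diff)
    moreover have "p \<in> topspace X - {d k}" using p dS(2)[of k] by auto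
    ultimately show "- {k} \<in> F" unfolding F_def by blast
  qed
  moreover have "countably_refined F"
    unfolding countably_refined_def
  proof (intro allI impI)
    fix \<A> assume A: "\<A> \<subseteq> F" "|\<A>| \<le>o omega1"
    have "\<exists>W. cozero X W \<and> p \<in> W \<and> d -` W \<subseteq> M" if M: "M \<in> \<A>" for M
    proof -
      obtain U where U: "openin X U" "p \<in> U" "d -` U \<subseteq> M" using M A(1) unfolding F_def by blast
      obtain W where "cozero X W" "p \<in> W" "W \<subseteq> U" using cozero_neighbourhood[OF cr U(1,2)] .
      then show ?thesis using U(3) by blast
    qed
    then obtain w where w: "\<And>M. M \<in> \<A> \<Longrightarrow> cozero X (w M) \<and> p \<in> w M \<and> d -` w M \<subseteq> M" by metis
    have card: "|w ` \<A>| \<le>o omega1" by (rule ordLeq_transitive[OF card_of_image A(2)])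
    have coz: "\<forall>W\<in>w ` \<A>. cozero X W" using w by auto
    from factorizable_generates_cozero[OF X(2) coz card]
    obtain \<C> where \<C>: "countable \<C>" "\<forall>C\<in>\<C>. openin X C"
      "\<forall>W\<in>w ` \<A>. \<forall>x\<in>W. \<exists>C\<in>\<C>. x \<in> C \<and> C \<subseteq> W"
      by (elim exE conjE)
    let ?D = "(\<lambda>C. d -` C) ` {C\<in>\<C>. p \<in> C}"
    have "?D \<subseteq> F" using \<C>(2) unfolding F_def by blast
    moreover have "countable ?D" using \<C>(1) by (simp add: countable_Collect)
    moreover have "refines ?D \<A>"
      unfolding refines_def
    proof
      fix M assume M: "M \<in> \<A>"
      then have "w M \<in> w ` \<A>" "p \<in> w M" using w[OF M] by auto
      then obtain C where "C \<in> \<C>" "p \<in> C" "C \<subseteq> w M" using \<C>(3) by meson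
      then show "\<exists>D\<in>?D. D \<subseteq> M" using w[OF M] by (intro bexI[of _ "d -` C"]) auto
    qed
    ultimately show "\<exists>\<C>\<subseteq>F. countable \<C> \<and> refines \<C> \<A>" by blast
  qed
  moreover have "\<not> countably_based F"
  proof
    assume "countably_based F"
    then obtain \<C> where \<C>: "\<C> \<subseteq> F" "countable \<C>" "refines \<C> F"
      by (auto simp: countably_based_def)
    have "\<forall>C\<in>\<C>. \<exists>U. openin X U \<and> p \<in> U \<and> d -` U \<subseteq> C" using \<C>(1) by (auto simp: F_def)
    then obtain u where u: "\<And>C. C \<in> \<C> \<Longrightarrow> openin X (u C) \<and> p \<in> u C \<and> d -` u C \<subseteq> C" by metis
    obtain U where U: "openin X U" "p \<in> U" "\<And>V. V \<in> u ` \<C> \<Longrightarrow> p \<in> V \<Longrightarrow> \<not> V \<subseteq> U"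
      using nolocal[of "u ` \<C>"] \<C>(2) u by (metis countable_image imageE)
    have "regular_space X" by (rule completely_regular_imp_regular_space[OF cr])
    then obtain V E where VE: "openin X V" "closedin X E" "p \<in> V" "V \<subseteq> E" "E \<subseteq> U"
      using U(1,2) neighbourhood_base_of_closedin[of X] unfolding neighbourhood_base_of by metis
    have "d -` V \<in> F" using VE(1,3) unfolding F_def by blast
    then obtain C where C: "C \<in> \<C>" "C \<subseteq> d -` V" using \<C>(3) by (auto simp: refines_def)
    \<comment> \<open>\<open>p\<close> itself may belong to \<open>S\<close>, although \<open>d\<close> does not enumerate it.\<close>
    have "u C \<inter> S \<subseteq> E"
    proof
      fix x assume x: "x \<in> u C \<inter> S"
      show "x \<in> E"
      proof (cases "x = p")
        case False
        then obtain n where n: "x = d n" using x bij by (auto simp: bij_betw_def)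
        then have "n \<in> d -` V" using x u[OF C(1)] C(2) by blast
        then show ?thesis using n VE(4) by auto
      qed (use VE in auto)
    qed
    then have "X closure_of (u C \<inter> S) \<subseteq> E" using VE(2) closure_of_minimal by blast
    moreover have "u C \<subseteq> X closure_of (u C \<inter> S)"
      using openin_Int_closure_of_subset[of X "u C" S] u[OF C(1)] S(3) openin_subset by fastforce
    ultimately have "u C \<subseteq> U" using VE(5) by blast
    then show False using U(3) C(1) u by blast
  qed
  ultimately show thesis by (rule that)
qed

section \<open>From a filter to a topological group\<close>

text \<open>Apply the hypothesis to the preimages under all coordinates of \<open>f\<close> of a countable base of \<open>\<real>\<close>.
Then \<open>f\<close> is continuous for the coarser topology \<open>Y\<close>, so that \<open>f\<close> factors through the identity map
onto \<open>Y\<close>.\<close>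
lemma factorizable_by_coarsening:
  assumes "\<And>\<U>. (\<And>U. U \<in> \<U> \<Longrightarrow> openin X U) \<Longrightarrow> |\<U>| \<le>o omega1 \<Longrightarrow>
    \<exists>Y. topspace Y = topspace X \<and> tychonoff_space Y \<and> second_countable Y \<and>
      (\<forall>U. openin Y U \<longrightarrow> openin X U) \<and> (\<forall>U\<in>\<U>. openin Y U)"
  shows "R_omega1_factorizable X"
  unfolding R_omega1_factorizable_def
proof (intro allI impI)
  fix f assume f: "continuous_map X R_pow_omega1 f"
  obtain \<B> :: "real set set" where \<B>: "countable \<B>" "\<And>B. B \<in> \<B> \<Longrightarrow> open B"
    "\<And>S. open S \<Longrightarrow> \<exists>U. U \<subseteq> \<B> \<and> S = \<Union>U"
    using univ_second_countable by metis
  let ?pre = "\<lambda>a B. {x \<in> topspace X. f x a \<in> B}"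
  define \<U> where "\<U> = (\<Union>a\<in>Field omega1. ?pre a ` \<B>)"
  have cf: "continuous_map X euclideanreal (\<lambda>x. f x a)" if "a \<in> Field omega1" for a
    using f that by (simp add: continuous_map_componentwise)
  have "openin X U" if "U \<in> \<U>" for U
    using that \<B>(2) openin_continuous_map_preimage[OF cf] by (auto simp: \<U>_def)
  moreover have "|\<U>| \<le>o omega1"
    unfolding \<U>_def
  proof (rule card_of_UNION_ordLeq_infinite_Field[OF infinite_omega1 Card_order_omega1])
    show "|Field omega1| \<le>o omega1"
      by (rule ordIso_imp_ordLeq[OF card_of_Field_ordIso[OF Card_order_omega1]])
    show "\<forall>a\<in>Field omega1. |?pre a ` \<B>| \<le>o omega1"
      using \<B>(1) by (intro ballI countable_imp_le_omega1 countable_image)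
  qed
  ultimately obtain Y where Y: "topspace Y = topspace X" "tychonoff_space Y" "second_countable Y"
    "\<And>U. openin Y U \<Longrightarrow> openin X U" "\<And>U. U \<in> \<U> \<Longrightarrow> openin Y U"
    using assms[of \<U>] by metis
  have "continuous_map X Y (\<lambda>x. x)"
    unfolding continuous_map_def
  proof (intro conjI allI impI)
    fix U assume U: "openin Y U"
    then have "{x \<in> topspace X. x \<in> U} = U" using openin_subset Y(1) by fastforce
    then show "openin X {x \<in> topspace X. x \<in> U}" using Y(4)[OF U] by simp
  qed (use Y(1) in auto)
  moreover have "continuous_map Y R_pow_omega1 f"
    unfolding continuous_map_componentwise
  proof (intro conjI ballI)
    show "f ` topspace Y \<subseteq> extensional (Field omega1)"
      using f Y(1) unfolding continuous_map_componentwise by simp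
    fix a assume a: "a \<in> Field omega1"
    show "continuous_map Y euclideanreal (\<lambda>x. f x a)"
      unfolding continuous_map_def
    proof (intro conjI allI impI)
      fix S :: "real set" assume "openin euclideanreal S"
      then obtain \<V> where \<V>: "\<V> \<subseteq> \<B>" "S = \<Union>\<V>" using \<B>(3)[of S] by auto
      have "{x \<in> topspace Y. f x a \<in> S} = \<Union>(?pre a ` \<V>)" using \<V>(2) Y(1) by auto
      moreover have "openin Y (\<Union>(?pre a ` \<V>))"
      proof (rule openin_Union)
        fix U assume "U \<in> ?pre a ` \<V>"
        then have "U \<in> \<U>" using \<V>(1) a unfolding \<U>_def by blast
        then show "openin Y U" by (rule Y(5))
      qed
      ultimately show "openin Y {x \<in> topspace Y. f x a \<in> S}" by simp
    qed auto
  qed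
  ultimately show "\<exists>(Y :: real topology) h g. tychonoff_space Y \<and> second_countable Y \<and>
      continuous_map X Y h \<and> continuous_map Y R_pow_omega1 g \<and> (\<forall>x\<in>topspace X. f x = (g \<circ> h) x)"
    by (intro factor_through_real[OF Y(2,3)]) auto
qed

unbundle bit_operations_syntax

text \<open>Through binary digits a natural number is a finite set of natural numbers, and bitwise exclusive or
is symmetric difference, so \<^typ>\<open>nat\<close> becomes the Boolean group of finite subsets of \<open>\<nat>\<close>.  The
subgroup of finite subsets of \<open>M\<close> is \<open>agree_off M 0\<close>, and \<open>agree_off M x\<close> is the coset of \<open>x\<close>.\<close>
definition agree_off :: "nat set \<Rightarrow> nat \<Rightarrow> nat set" where
  "agree_off M x = {y. \<forall>k. k \<notin> M \<longrightarrow> bit x k = bit y k}"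

text \<open>The group topology in which the subgroups belonging to the members of \<open>F\<close> form a base of
neighbourhoods of zero.\<close>
definition bit_topology :: "nat set set \<Rightarrow> nat topology" where
  "bit_topology F = topology (\<lambda>U. \<forall>x\<in>U. \<exists>M\<in>F. agree_off M x \<subseteq> U)"

lemma agree_off_self: "x \<in> agree_off M x"
  by (simp add: agree_off_def)

lemma agree_off_eq: "y \<in> agree_off M x \<Longrightarrow> agree_off M y = agree_off M x"
  by (auto simp: agree_off_def)

lemma agree_off_mono: "M \<subseteq> N \<Longrightarrow> agree_off M x \<subseteq> agree_off N x"
  by (auto simp: agree_off_def)

lemma openin_bit_topology:
  assumes F: "free_filter F"
  shows "openin (bit_topology F) U \<longleftrightarrow> (\<forall>x\<in>U. \<exists>M\<in>F. agree_off M x \<subseteq> U)"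
proof -
  have "istopology (\<lambda>U. \<forall>x\<in>U. \<exists>M\<in>F. agree_off M x \<subseteq> U)"
    unfolding istopology_def
  proof (intro conjI allI impI ballI)
    fix U V x
    assume U: "\<forall>x\<in>U. \<exists>M\<in>F. agree_off M x \<subseteq> U" and V: "\<forall>x\<in>V. \<exists>M\<in>F. agree_off M x \<subseteq> V"
      and x: "x \<in> U \<inter> V"
    obtain M N where M: "M \<in> F" "agree_off M x \<subseteq> U" and N: "N \<in> F" "agree_off N x \<subseteq> V"
      using U V x by blast
    have "M \<inter> N \<in> F" using F M(1) N(1) by (simp add: free_filter_def)
    moreover have "agree_off (M \<inter> N) x \<subseteq> U \<inter> V"
      using M(2) N(2) agree_off_mono[of "M \<inter> N" M x] agree_off_mono[of "M \<inter> N" N x] by blast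
    ultimately show "\<exists>M\<in>F. agree_off M x \<subseteq> U \<inter> V" by blast
  next
    fix \<K> x assume K: "\<forall>U\<in>\<K>. \<forall>x\<in>U. \<exists>M\<in>F. agree_off M x \<subseteq> U" and "x \<in> \<Union>\<K>"
    then obtain U where "U \<in> \<K>" "x \<in> U" by blast
    then obtain M where "M \<in> F" "agree_off M x \<subseteq> U" using K by blast
    then show "\<exists>M\<in>F. agree_off M x \<subseteq> \<Union>\<K>" using \<open>U \<in> \<K>\<close> by blast
  qed
  then show ?thesis by (simp add: bit_topology_def)
qed

lemma topspace_bit_topology:
  assumes "free_filter F" shows "topspace (bit_topology F) = UNIV"
proof -
  have "- {0} \<in> F" using assms by (simp add: free_filter_def)
  then have "openin (bit_topology F) UNIV"
    by (auto simp: openin_bit_topology[OF assms])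
  then show ?thesis using openin_subset by blast
qed

lemma openin_agree_off:
  assumes "free_filter F" "M \<in> F" shows "openin (bit_topology F) (agree_off M x)"
  using assms by (auto simp: openin_bit_topology agree_off_eq intro!: bexI[of _ M])

lemma closedin_agree_off:
  assumes F: "free_filter F" and M: "M \<in> F" shows "closedin (bit_topology F) (agree_off M x)"
proof -
  have "openin (bit_topology F) (- agree_off M x)"
    unfolding openin_bit_topology[OF F]
  proof
    fix y assume "y \<in> - agree_off M x"
    then have "agree_off M y \<subseteq> - agree_off M x" by (auto simp: agree_off_def)
    then show "\<exists>M'\<in>F. agree_off M' y \<subseteq> - agree_off M x" using M by blast
  qed
  then show ?thesis by (simp add: closedin_def topspace_bit_topology[OF F] Compl_eq_Diff_UNIV)
qed

lemma tychonoff_bit_topology: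
  assumes F: "free_filter F" shows "tychonoff_space (bit_topology F)"
  unfolding tychonoff_space_def
proof
  have "bit_topology F dim_le 0"
    unfolding dimension_le_0_neighbourhood_base_of_clopen
  proof (subst open_neighbourhood_base_of; intro allI impI)
    fix W x assume W: "openin (bit_topology F) W \<and> x \<in> W"
    then obtain M where M: "M \<in> F" "agree_off M x \<subseteq> W" by (auto simp: openin_bit_topology[OF F])
    then show "\<exists>U. (closedin (bit_topology F) U \<and> openin (bit_topology F) U) \<and> x \<in> U \<and> U \<subseteq> W"
      using closedin_agree_off[OF F M(1)] openin_agree_off[OF F M(1)] agree_off_self by blast
  qed auto
  then show "completely_regular_space (bit_topology F)"
    by (rule zero_dimensional_imp_completely_regular_space)
  show "Hausdorff_space (bit_topology F)"
    unfolding Hausdorff_space_def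
  proof (intro allI impI)
    fix x y assume "x \<in> topspace (bit_topology F) \<and> y \<in> topspace (bit_topology F) \<and> x \<noteq> y"
    then obtain k where k: "bit x k \<noteq> bit y k" using bit_eqI by blast
    have "- {k} \<in> F" using F by (simp add: free_filter_def)
    then have "openin (bit_topology F) (agree_off (- {k}) z)" for z
      using openin_agree_off[OF F] by blast
    moreover have "disjnt (agree_off (- {k}) x) (agree_off (- {k}) y)"
      using k by (auto simp: disjnt_iff agree_off_def)
    ultimately show "\<exists>U V. openin (bit_topology F) U \<and> openin (bit_topology F) V \<and>
        x \<in> U \<and> y \<in> V \<and> disjnt U V"
      using agree_off_self[of x "- {k}"] agree_off_self[of y "- {k}"] by meson
  qed
qed

lemma tychonoff_subtopology: "tychonoff_space X \<Longrightarrow> tychonoff_space (subtopology X S)"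
  by (simp add: tychonoff_space_def completely_regular_space_subtopology Hausdorff_space_subtopology)

lemma second_countable_bit_topology:
  assumes F: "free_filter F" and cb: "countably_based F"
  shows "second_countable (bit_topology F)"
proof -
  obtain \<C> where \<C>: "\<C> \<subseteq> F" "countable \<C>" "refines \<C> F"
    using cb by (auto simp: countably_based_def)
  let ?B = "(\<lambda>(M, x). agree_off M x) ` (\<C> \<times> UNIV)"
  show ?thesis
    unfolding second_countable_def
  proof (intro exI[of _ ?B] conjI ballI allI impI)
    show "countable ?B" using \<C>(2) by simp
    show "openin (bit_topology F) V" if "V \<in> ?B" for V
      using that \<C>(1) openin_agree_off[OF F] by auto
    fix U x assume "openin (bit_topology F) U \<and> x \<in> U"
    then obtain M where M: "M \<in> F" "agree_off M x \<subseteq> U" by (auto simp: openin_bit_topology[OF F])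
    then obtain C where C: "C \<in> \<C>" "C \<subseteq> M" using \<C>(3) by (auto simp: refines_def)
    then have "agree_off C x \<subseteq> U" using M(2) agree_off_mono by blast
    then show "\<exists>V\<in>?B. x \<in> V \<and> V \<subseteq> U" using C(1) agree_off_self by blast
  qed
qed

text \<open>An open set is a union of countably many cosets, the group being countable.  Hence \<open>\<omega>\<^sub>1\<close> many open
sets involve only \<open>\<omega>\<^sub>1\<close> many members of \<open>F\<close>, and a countable part of \<open>F\<close> refines them all.\<close>
lemma omega1_open_sets_in_second_countable:
  assumes F: "free_filter F" and cr: "countably_refined F"
    and \<U>: "\<And>U. U \<in> \<U> \<Longrightarrow> openin (bit_topology F) U" "|\<U>| \<le>o omega1"
  obtains G where "G \<subseteq> F" "free_filter G" "countably_based G"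
    "\<And>U. U \<in> \<U> \<Longrightarrow> openin (bit_topology G) U"
proof -
  have "\<forall>p\<in>Sigma \<U> (\<lambda>U. U). \<exists>M. M \<in> F \<and> agree_off M (snd p) \<subseteq> fst p"
    using \<U>(1) by (fastforce simp: openin_bit_topology[OF F])
  from bchoice[OF this] obtain m
    where m: "\<forall>p\<in>Sigma \<U> (\<lambda>U. U). m p \<in> F \<and> agree_off (m p) (snd p) \<subseteq> fst p" ..
  have "|Sigma \<U> (\<lambda>U. U)| \<le>o omega1"
    by (rule card_of_Sigma_ordLeq_infinite_Field[OF infinite_omega1 Card_order_omega1 \<U>(2)])
      (simp add: countable_imp_le_omega1)
  then have "|m ` Sigma \<U> (\<lambda>U. U)| \<le>o omega1"
    by (rule ordLeq_transitive[OF card_of_image])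
  moreover have "m ` Sigma \<U> (\<lambda>U. U) \<subseteq> F" using m by blast
  ultimately obtain \<C> where \<C>: "\<C> \<subseteq> F" "countable \<C>" "refines \<C> (m ` Sigma \<U> (\<lambda>U. U))"
    using cr unfolding countably_refined_def by meson
  obtain \<D> where \<D>: "countable \<D>" "\<D> \<subseteq> F" "\<C> \<subseteq> \<D>" "\<And>k. - {k} \<in> \<D>"
    "\<And>A B. A \<in> \<D> \<Longrightarrow> B \<in> \<D> \<Longrightarrow> A \<inter> B \<in> \<D>"
    using countable_filter_base[OF F \<C>(2,1)] by metis
  define G where "G = {A. \<exists>D\<in>\<D>. D \<subseteq> A}"
  have G: "free_filter G"
    unfolding G_def using \<D>(4,5) by (intro free_filter_upward_closure) blast+
  have DG: "\<D> \<subseteq> G" by (auto simp: G_def)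
  show thesis
  proof (rule that[OF _ G])
    show "G \<subseteq> F" using F \<D>(2) unfolding G_def free_filter_def by blast
    show "countably_based G"
      using \<D>(1) DG by (auto simp: countably_based_def refines_def G_def)
    fix U assume U: "U \<in> \<U>"
    show "openin (bit_topology G) U"
      unfolding openin_bit_topology[OF G]
    proof
      fix x assume x: "x \<in> U"
      then have "m (U, x) \<in> m ` Sigma \<U> (\<lambda>U. U)" using U by blast
      then obtain C where C: "C \<in> \<C>" "C \<subseteq> m (U, x)"
        using \<C>(3) unfolding refines_def by meson
      then have "agree_off C x \<subseteq> U"
        using m U x agree_off_mono[OF C(2), of x] by fastforce
      then show "\<exists>M\<in>G. agree_off M x \<subseteq> U" using C(1) \<D>(3) DG by blast
    qed
  qed
qed

lemma factorizable_bit_topology: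
  assumes F: "free_filter F" and cr: "countably_refined F"
  shows "R_omega1_factorizable (subtopology (bit_topology F) S)"
proof (rule factorizable_by_coarsening)
  fix \<U> assume \<U>: "\<And>U. U \<in> \<U> \<Longrightarrow> openin (subtopology (bit_topology F) S) U" "|\<U>| \<le>o omega1"
  have "\<forall>U\<in>\<U>. \<exists>V. openin (bit_topology F) V \<and> U = V \<inter> S"
    using \<U>(1) by (auto simp: openin_subtopology)
  from bchoice[OF this] obtain v where v: "\<forall>U\<in>\<U>. openin (bit_topology F) (v U) \<and> U = v U \<inter> S" ..
  have v': "openin (bit_topology F) V" if "V \<in> v ` \<U>" for V using that v by blast
  obtain G where G: "G \<subseteq> F" "free_filter G" "countably_based G"
    "\<And>V. V \<in> v ` \<U> \<Longrightarrow> openin (bit_topology G) V"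
    using omega1_open_sets_in_second_countable[OF F cr v' ordLeq_transitive[OF card_of_image \<U>(2)]]
    by blast
  have coarser: "openin (bit_topology F) U" if "openin (bit_topology G) U" for U
    using that G(1) unfolding openin_bit_topology[OF G(2)] openin_bit_topology[OF F] by blast
  let ?Y = "subtopology (bit_topology G) S"
  show "\<exists>Y. topspace Y = topspace (subtopology (bit_topology F) S) \<and> tychonoff_space Y \<and>
      second_countable Y \<and> (\<forall>U. openin Y U \<longrightarrow> openin (subtopology (bit_topology F) S) U) \<and>
      (\<forall>U\<in>\<U>. openin Y U)"
  proof (intro exI[of _ ?Y] conjI allI impI ballI)
    show "topspace ?Y = topspace (subtopology (bit_topology F) S)"
      by (simp add: topspace_bit_topology F G(2))
    show "tychonoff_space ?Y" by (intro tychonoff_subtopology tychonoff_bit_topology G(2))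
    show "second_countable ?Y"
      by (intro second_countable_subtopology second_countable_bit_topology G(2,3))
    show "openin (subtopology (bit_topology F) S) U" if "openin ?Y U" for U
      using that coarser by (auto simp: openin_subtopology)
    fix U assume U: "U \<in> \<U>"
    then have "openin (bit_topology G) (v U)" "U = v U \<inter> S" using G(4) v by auto
    then show "openin ?Y U" unfolding openin_subtopology by blast
  qed
qed

lemma continuous_xor:
  assumes F: "free_filter F"
  shows "continuous_map (prod_topology (bit_topology F) (bit_topology F)) (bit_topology F)
    (\<lambda>(x, y). x XOR y)"
  unfolding continuous_map_def
proof (intro conjI allI impI)
  fix U assume U: "openin (bit_topology F) U"
  show "openin (prod_topology (bit_topology F) (bit_topology F))
      {p \<in> topspace (prod_topology (bit_topology F) (bit_topology F)). (case p of (x, y) \<Rightarrow> x XOR y) \<in> U}"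
    unfolding openin_prod_topology_alt
  proof (intro allI impI)
    fix x y
    assume "(x, y) \<in> {p \<in> topspace (prod_topology (bit_topology F) (bit_topology F)).
      (case p of (x, y) \<Rightarrow> x XOR y) \<in> U}"
    then have "x XOR y \<in> U" by simp
    then obtain M where M: "M \<in> F" "agree_off M (x XOR y) \<subseteq> U"
      using U by (auto simp: openin_bit_topology[OF F])
    have "a XOR b \<in> agree_off M (x XOR y)" if "a \<in> agree_off M x" "b \<in> agree_off M y" for a b
      using that by (simp add: agree_off_def bit_xor_iff)
    then have "agree_off M x \<times> agree_off M y \<subseteq>
      {p \<in> topspace (prod_topology (bit_topology F) (bit_topology F)). (case p of (x, y) \<Rightarrow> x XOR y) \<in> U}"
      using M(2) by (auto simp: topspace_bit_topology[OF F])
    then show "\<exists>V W. openin (bit_topology F) V \<and> openin (bit_topology F) W \<and> x \<in> V \<and> y \<in> W \<and>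
        V \<times> W \<subseteq> {p \<in> topspace (prod_topology (bit_topology F) (bit_topology F)).
          (case p of (x, y) \<Rightarrow> x XOR y) \<in> U}"
      using openin_agree_off[OF F M(1)] agree_off_self
      by (intro exI[of _ "agree_off M x"] exI[of _ "agree_off M y"] conjI)
  qed
qed (simp add: topspace_bit_topology[OF F])

section \<open>The subspace with a single nonisolated point\<close>

text \<open>Zero and the singletons \<open>{k}\<close>, encoded as \<open>2 ^ k\<close>.  This is \<open>\<nat>\<close> as a discrete space together with a
point at infinity whose neighbourhoods are the members of \<open>F\<close>.  As a subspace of the group it
inherits the Tychonoff property and factorizability.\<close>
definition filter_space :: "nat set set \<Rightarrow> nat topology" where
  "filter_space F = subtopology (bit_topology F) (insert 0 (range (\<lambda>k. 2 ^ k)))"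

lemma topspace_filter_space:
  "free_filter F \<Longrightarrow> topspace (filter_space F) = insert 0 (range (\<lambda>k. 2 ^ k))"
  by (simp add: filter_space_def topspace_bit_topology)

lemma power2_in_agree_off_0: "2 ^ k \<in> agree_off M 0 \<longleftrightarrow> k \<in> M"
  by (auto simp: agree_off_def bit_exp_iff)

lemma trace_in_filter:
  assumes F: "free_filter F" and U: "openin (filter_space F) U" "0 \<in> U"
  shows "{k. 2 ^ k \<in> U} \<in> F"
proof -
  obtain V where V: "openin (bit_topology F) V" "U = V \<inter> insert 0 (range (\<lambda>k. 2 ^ k))"
    using U(1) by (auto simp: filter_space_def openin_subtopology)
  then obtain M where M: "M \<in> F" "agree_off M 0 \<subseteq> V"
    using U(2) by (auto simp: openin_bit_topology[OF F])
  then have "M \<subseteq> {k. 2 ^ k \<in> U}" using V(2) power2_in_agree_off_0 by blast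
  then show ?thesis using F M(1) by (simp add: free_filter_def)
qed

text \<open>A local base at \<open>0\<close> yields a base of \<open>F\<close> of at most the same cardinality.  This bounds both the
character and the weight from below.\<close>
lemma local_base_trace_refines:
  assumes F: "free_filter F"
    and \<B>: "\<And>U. openin (filter_space F) U \<Longrightarrow> 0 \<in> U \<Longrightarrow> \<exists>V\<in>\<B>. 0 \<in> V \<and> V \<subseteq> U"
  shows "refines ((\<lambda>V. {k. 2 ^ k \<in> V}) ` {V\<in>\<B>. 0 \<in> V}) F"
  unfolding refines_def
proof
  fix M assume M: "M \<in> F"
  let ?U = "agree_off M 0 \<inter> insert 0 (range (\<lambda>k. 2 ^ k))"
  have "openin (filter_space F) ?U"
    using openin_agree_off[OF F M] by (auto simp: filter_space_def openin_subtopology)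
  moreover have "0 \<in> ?U" by (simp add: agree_off_self)
  ultimately obtain V where V: "V \<in> \<B>" "0 \<in> V" "V \<subseteq> ?U" using \<B> by meson
  then have "{k. 2 ^ k \<in> V} \<subseteq> M" using power2_in_agree_off_0 by blast
  then show "\<exists>C\<in>(\<lambda>V. {k. 2 ^ k \<in> V}) ` {V\<in>\<B>. 0 \<in> V}. C \<subseteq> M" using V by blast
qed

lemma not_metrizable_filter_space:
  assumes F: "free_filter F" and nb: "\<not> countably_based F"
  shows "\<not> metrizable_space (filter_space F)"
proof
  assume "metrizable_space (filter_space F)"
  then have "first_countable (filter_space F)" by (rule metrizable_imp_first_countable)
  then obtain \<B> where \<B>: "countable \<B>" "\<And>V. V \<in> \<B> \<Longrightarrow> openin (filter_space F) V"
    "\<And>U. openin (filter_space F) U \<Longrightarrow> 0 \<in> U \<Longrightarrow> \<exists>V\<in>\<B>. 0 \<in> V \<and> V \<subseteq> U"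
    unfolding first_countable_def topspace_filter_space[OF F] by (metis insertI1)
  let ?C = "(\<lambda>V. {k. 2 ^ k \<in> V}) ` {V\<in>\<B>. 0 \<in> V}"
  have "refines ?C F" using local_base_trace_refines[OF F \<B>(3)] by simp
  moreover have "?C \<subseteq> F" using \<B>(2) trace_in_filter[OF F] by blast
  moreover have "countable ?C" using \<B>(1) by (simp add: countable_Collect)
  ultimately show False using nb by (auto simp: countably_based_def)
qed

lemma single_nonisolated_filter_space:
  assumes F: "free_filter F" and nb: "\<not> countably_based F"
  shows "single_nonisolated_point (filter_space F)"
  unfolding single_nonisolated_point_def
proof (rule ex1I[of _ 0])
  have "\<not> openin (filter_space F) {0}"
  proof
    assume "openin (filter_space F) {0}"
    then have "{k :: nat. 2 ^ k \<in> {0 :: nat}} \<in> F" by (rule trace_in_filter[OF F]) simp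
    then have "{} \<in> F" by simp
    then have "countably_based F"
      by (auto simp: countably_based_def refines_def intro!: exI[of _ "{{}}"])
    then show False using nb by simp
  qed
  then show "0 \<in> topspace (filter_space F) \<and> \<not> openin (filter_space F) {0}"
    by (simp add: topspace_filter_space[OF F])
next
  fix x assume x: "x \<in> topspace (filter_space F) \<and> \<not> openin (filter_space F) {x}"
  show "x = 0"
  proof (rule ccontr)
    assume "x \<noteq> 0"
    then obtain k where k: "x = 2 ^ k" using x by (auto simp: topspace_filter_space[OF F])
    have "- {k} \<in> F" using F by (simp add: free_filter_def)
    then have "openin (bit_topology F) (agree_off (- {k}) x)" by (rule openin_agree_off[OF F])
    moreover have "{x} = agree_off (- {k}) x \<inter> insert 0 (range (\<lambda>k. 2 ^ k))"
      unfolding k by (auto simp: agree_off_def bit_exp_iff)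
    ultimately have "openin (filter_space F) {x}"
      unfolding filter_space_def openin_subtopology by blast
    then show False using x by simp
  qed
qed

lemma weight_filter_space:
  assumes F: "free_filter F" and base: "\<exists>\<B>\<subseteq>F. |\<B>| \<le>o omega2 \<and> refines \<B> F"
    and large: "\<And>\<B>. \<B> \<subseteq> F \<Longrightarrow> refines \<B> F \<Longrightarrow> omega2 \<le>o |\<B>|"
  shows "has_weight (filter_space F) omega2"
proof -
  have lower: "omega2 \<le>o |\<V>|" if \<V>: "is_base \<V> (filter_space F)" for \<V>
  proof -
    let ?C = "(\<lambda>V. {k. 2 ^ k \<in> V}) ` {V\<in>\<V>. 0 \<in> V}"
    have "refines ?C F"
      using \<V> by (intro local_base_trace_refines[OF F]) (auto simp: is_base_def)
    moreover have "?C \<subseteq> F" using \<V> trace_in_filter[OF F] by (auto simp: is_base_def)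
    ultimately have "omega2 \<le>o |?C|" using large by blast
    also have "|?C| \<le>o |{V\<in>\<V>. 0 \<in> V}|" by (rule card_of_image)
    also have "|{V\<in>\<V>. 0 \<in> V}| \<le>o |\<V>|" by (rule card_of_mono1) auto
    finally show ?thesis .
  qed
  obtain \<B> where \<B>: "\<B> \<subseteq> F" "|\<B>| \<le>o omega2" "refines \<B> F" using base by blast
  let ?S = "insert 0 (range (\<lambda>k. 2 ^ k))"
  let ?V = "(\<lambda>(M, x). agree_off M x \<inter> ?S) ` (\<B> \<times> UNIV)"
  have isb: "is_base ?V (filter_space F)"
    unfolding is_base_def
  proof (intro conjI ballI allI impI)
    fix V assume "V \<in> ?V"
    then obtain M x where "M \<in> \<B>" "V = agree_off M x \<inter> ?S" by auto
    then show "openin (filter_space F) V"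
      using \<B>(1) openin_agree_off[OF F, of M x] unfolding filter_space_def openin_subtopology by auto
  next
    fix U x assume "openin (filter_space F) U \<and> x \<in> U"
    then obtain W where W: "openin (bit_topology F) W" "U = W \<inter> ?S" "x \<in> W" "x \<in> ?S"
      by (auto simp: filter_space_def openin_subtopology)
    then obtain M where M: "M \<in> F" "agree_off M x \<subseteq> W" using openin_bit_topology[OF F] by blast
    then obtain B where B: "B \<in> \<B>" "B \<subseteq> M" using \<B>(3) by (auto simp: refines_def)
    then have "agree_off B x \<subseteq> W" using M(2) agree_off_mono by blast
    then show "\<exists>V\<in>?V. x \<in> V \<and> V \<subseteq> U"
      using B(1) W(2,4) agree_off_self[of x B]
      by (intro bexI[of _ "agree_off B x \<inter> ?S"]) auto
  qed
  have "|\<B> \<times> (UNIV :: nat set)| \<le>o omega2"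
  proof (rule card_of_Times_ordLeq_infinite_Field[OF infinite_omega2 \<B>(2) _ Card_order_omega2])
    show "|UNIV :: nat set| \<le>o omega2"
      by (rule ordLeq_transitive[OF countable_imp_le_omega1 cardSuc_ordLeq[OF Card_order_omega1]]) simp
  qed
  then have "|?V| \<le>o omega2" by (rule ordLeq_transitive[OF card_of_image])
  then have "|?V| =o omega2" using lower[OF isb] by (simp add: ordIso_iff_ordLeq)
  then show ?thesis unfolding has_weight_def using isb lower by blast
qed

section \<open>Transfer along homeomorphisms\<close>
lemma homeomorphic_copy:
  assumes inj: "inj_on f (topspace X)"
  obtains Y where "homeomorphic_map X Y f"
proof -
  let ?S = "topspace X"
  define k where "k = inv_into ?S f"
  define Y where "Y = pullback_topology (f ` ?S) k X"
  have kf: "k (f x) = x" if "x \<in> ?S" for x using inj that by (simp add: k_def)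
  have tY: "topspace Y = f ` ?S" by (auto simp: Y_def topspace_pullback_topology kf)
  have "continuous_map X Y f"
    unfolding Y_def
  proof (rule continuous_map_pullback')
    show "continuous_map X X (k \<circ> f)"
      by (rule continuous_map_eq[OF continuous_map_id]) (simp add: kf)
  qed auto
  moreover have "continuous_map Y X k"
    using continuous_map_pullback[OF continuous_map_id, of "f ` ?S" k X] by (simp add: Y_def)
  ultimately have "homeomorphic_maps X Y f k" by (auto simp: homeomorphic_maps_def tY kf)
  then show thesis using that homeomorphic_map_maps by blast
qed

lemma homeomorphic_map_inverse:
  assumes "homeomorphic_map X Y f"
  obtains k where "homeomorphic_map Y X k" "continuous_map X Y f" "continuous_map Y X k"
    "\<And>x. x \<in> topspace X \<Longrightarrow> k (f x) = x" "\<And>y. y \<in> topspace Y \<Longrightarrow> f (k y) = y"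
  using assms unfolding homeomorphic_map_maps homeomorphic_maps_def by blast

lemma tychonoff_homeomorphic:
  assumes "X homeomorphic_space Y" "tychonoff_space X" shows "tychonoff_space Y"
  using assms homeomorphic_completely_regular_space homeomorphic_Hausdorff_space
  unfolding tychonoff_space_def by blast

lemma factorizable_homeomorphic:
  assumes hom: "homeomorphic_map X Y e" and X: "R_omega1_factorizable X"
  shows "R_omega1_factorizable Y"
  unfolding R_omega1_factorizable_def
proof (intro allI impI)
  fix f assume f: "continuous_map Y R_pow_omega1 f"
  obtain k where k: "continuous_map X Y e" "continuous_map Y X k"
    "\<And>y. y \<in> topspace Y \<Longrightarrow> e (k y) = y"
    using homeomorphic_map_inverse[OF hom] by metis
  have "continuous_map X R_pow_omega1 (f \<circ> e)" by (rule continuous_map_compose[OF k(1) f])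
  then obtain Z :: "real topology" and h g where Z: "tychonoff_space Z" "second_countable Z"
    "continuous_map X Z h" "continuous_map Z R_pow_omega1 g"
    and eq: "\<forall>x\<in>topspace X. (f \<circ> e) x = (g \<circ> h) x"
    using X unfolding R_omega1_factorizable_def by meson
  have "f y = (g \<circ> (h \<circ> k)) y" if y: "y \<in> topspace Y" for y
  proof -
    have "k y \<in> topspace X" using k(2) y by (auto simp: continuous_map_def)
    then show ?thesis using eq k(3)[OF y] by force
  qed
  then show "\<exists>(Z :: real topology) h g. tychonoff_space Z \<and> second_countable Z \<and>
      continuous_map Y Z h \<and> continuous_map Z R_pow_omega1 g \<and>
      (\<forall>y\<in>topspace Y. f y = (g \<circ> h) y)"
    using Z continuous_map_compose[OF k(2) Z(3)] by blast
qed

lemma single_nonisolated_homeomorphic: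
  assumes hom: "homeomorphic_map X Y e" and X: "single_nonisolated_point X"
  shows "single_nonisolated_point Y"
proof -
  have Y: "topspace Y = e ` topspace X" using hom homeomorphic_imp_surjective_map by metis
  have iso: "openin Y {e x} \<longleftrightarrow> openin X {x}" if "x \<in> topspace X" for x
    using homeomorphic_map_openness[OF hom, of "{x}"] that by simp
  obtain p where p: "p \<in> topspace X" "\<not> openin X {p}"
    "\<And>x. x \<in> topspace X \<Longrightarrow> \<not> openin X {x} \<Longrightarrow> x = p"
    using X unfolding single_nonisolated_point_def by metis
  show ?thesis
    unfolding single_nonisolated_point_def
  proof (rule ex1I[of _ "e p"])
    show "e p \<in> topspace Y \<and> \<not> openin Y {e p}" using p(1,2) iso Y by simp
    fix y assume "y \<in> topspace Y \<and> \<not> openin Y {y}"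
    then obtain x where "x \<in> topspace X" "y = e x" "\<not> openin X {x}" using iso Y by auto
    then show "y = e p" using p(3) by simp
  qed
qed

lemma is_base_homeomorphic:
  assumes hom: "homeomorphic_map X Y e" and B: "is_base \<B> X"
  shows "is_base ((`) e ` \<B>) Y"
  unfolding is_base_def
proof (intro conjI ballI allI impI)
  fix V assume "V \<in> (`) e ` \<B>"
  then obtain B where "B \<in> \<B>" "V = e ` B" by blast
  then show "openin Y V"
    using B hom homeomorphic_map_openness_eq unfolding is_base_def by metis
next
  fix U y assume U: "openin Y U \<and> y \<in> U"
  obtain k where k: "continuous_map X Y e" "continuous_map Y X k"
    "\<And>y. y \<in> topspace Y \<Longrightarrow> e (k y) = y"
    using homeomorphic_map_inverse[OF hom] by metis
  have y: "y \<in> topspace Y" using U openin_subset by blast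
  have "openin X {x \<in> topspace X. e x \<in> U}" using openin_continuous_map_preimage[OF k(1)] U by blast
  moreover have "k y \<in> {x \<in> topspace X. e x \<in> U}"
    using k(2) k(3)[OF y] y U by (auto simp: continuous_map_def)
  ultimately obtain B where B': "B \<in> \<B>" "k y \<in> B" "B \<subseteq> {x \<in> topspace X. e x \<in> U}"
    using B unfolding is_base_def by meson
  then have "y \<in> e ` B" "e ` B \<subseteq> U" using k(3)[OF y] by (force, blast)
  then show "\<exists>V\<in>(`) e ` \<B>. y \<in> V \<and> V \<subseteq> U" using B'(1) by blast
qed

lemma has_weight_homeomorphic:
  assumes hom: "homeomorphic_map X Y e" and X: "has_weight X \<kappa>"
  shows "has_weight Y \<kappa>"
proof -
  obtain k where k: "homeomorphic_map Y X k" using homeomorphic_map_inverse[OF hom] by metis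
  obtain \<B> where \<B>: "is_base \<B> X" "|\<B>| =o \<kappa>" using X unfolding has_weight_def by blast
  have lower: "\<kappa> \<le>o |\<V>|" if \<V>: "is_base \<V> Y" for \<V>
  proof -
    have "\<kappa> \<le>o |(`) k ` \<V>|"
      using is_base_homeomorphic[OF k \<V>] X unfolding has_weight_def by blast
    then show ?thesis by (rule ordLeq_transitive[OF _ card_of_image])
  qed
  have base: "is_base ((`) e ` \<B>) Y" by (rule is_base_homeomorphic[OF hom \<B>(1)])
  have "|(`) e ` \<B>| \<le>o \<kappa>" by (rule ordLeq_ordIso_trans[OF card_of_image \<B>(2)])
  then have "|(`) e ` \<B>| =o \<kappa>" using lower[OF base] by (simp add: ordIso_iff_ordLeq)
  then show ?thesis unfolding has_weight_def using base lower by blast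
qed

section \<open>The equivalence\<close>
lemma filter_imp_space:
  assumes inf: "infinite (UNIV :: 'x set)"
    and F: "free_filter F" "countably_refined F" "\<not> countably_based F"
  shows "\<exists>X :: 'x topology. tychonoff_space X \<and> countable (topspace X) \<and> \<not> metrizable_space X \<and>
    R_omega1_factorizable X \<and> has_weight X omega2 \<and> single_nonisolated_point X"
proof -
  obtain G where G: "free_filter G" "countably_refined G" "\<not> countably_based G"
    "\<exists>\<B>\<subseteq>G. |\<B>| \<le>o omega2 \<and> refines \<B> G"
    "\<And>\<B>. \<B> \<subseteq> G \<Longrightarrow> refines \<B> G \<Longrightarrow> omega2 \<le>o |\<B>|"
    using filter_of_character_omega2[OF F] by metis
  obtain f :: "nat \<Rightarrow> 'x" where "inj f" using infinite_countable_subset[OF inf] by blast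
  then have "inj_on f (topspace (filter_space G))" using inj_on_subset by blast
  then obtain Y where hom: "homeomorphic_map (filter_space G) Y f" by (rule homeomorphic_copy)
  then have hs: "filter_space G homeomorphic_space Y" by (rule homeomorphic_map_imp_homeomorphic_space)
  have "tychonoff_space (filter_space G)"
    unfolding filter_space_def by (intro tychonoff_subtopology tychonoff_bit_topology G(1))
  then have "tychonoff_space Y" by (rule tychonoff_homeomorphic[OF hs])
  moreover have "countable (topspace Y)"
    using homeomorphic_imp_surjective_map[OF hom] by (metis countable_image countableI_type)
  moreover have "\<not> metrizable_space Y"
    using homeomorphic_metrizable_space[OF hs] not_metrizable_filter_space[OF G(1,3)] by simp
  moreover have "R_omega1_factorizable Y"
    by (rule factorizable_homeomorphic[OF hom, unfolded filter_space_def])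
      (rule factorizable_bit_topology[OF G(1,2)])
  moreover have "has_weight Y omega2"
    by (rule has_weight_homeomorphic[OF hom weight_filter_space[OF G(1,4,5)]])
  moreover have "single_nonisolated_point Y"
    by (rule single_nonisolated_homeomorphic[OF hom single_nonisolated_filter_space[OF G(1,3)]])
  ultimately show ?thesis by blast
qed

lemma filter_imp_group:
  assumes inf: "infinite (UNIV :: 'x set)"
    and F: "free_filter F" "countably_refined F" "\<not> countably_based F"
  shows "\<exists>(G :: 'x monoid) T. topological_group G T \<and> tychonoff_space T \<and> \<not> metrizable_space T \<and>
    R_omega1_factorizable T"
proof -
  let ?X = "bit_topology F"
  have tX: "topspace ?X = UNIV" by (rule topspace_bit_topology[OF F(1)])
  obtain f :: "nat \<Rightarrow> 'x" where f: "inj f" using infinite_countable_subset[OF inf] by blast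
  then obtain T where hom: "homeomorphic_map ?X T f" using homeomorphic_copy[of f ?X] tX by metis
  then have hs: "?X homeomorphic_space T" by (rule homeomorphic_map_imp_homeomorphic_space)
  obtain k where k: "continuous_map ?X T f" "continuous_map T ?X k" "\<And>n. k (f n) = n"
    using homeomorphic_map_inverse[OF hom] tX by (metis UNIV_I)
  have tT: "topspace T = range f" using homeomorphic_imp_surjective_map[OF hom] tX by simp
  define G :: "'x monoid" where
    "G = \<lparr>carrier = range f, mult = (\<lambda>x y. f (k x XOR k y)), one = f 0\<rparr>"
  have G: "group G"
  proof (rule groupI)
    show "\<exists>y\<in>carrier G. y \<otimes>\<^bsub>G\<^esub> x = \<one>\<^bsub>G\<^esub>" if "x \<in> carrier G" for x
      using that by (intro bexI[of _ x]) (auto simp: G_def)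
  qed (auto simp: G_def k(3) xor.assoc)
  have inv: "inv\<^bsub>G\<^esub> x = x" if "x \<in> carrier G" for x
    by (rule group.inv_equality[OF G _ that that]) (simp add: G_def)
  have "continuous_map (prod_topology T T) T (\<lambda>(x, y). x \<otimes>\<^bsub>G\<^esub> y)"
  proof -
    have "continuous_map (prod_topology T T) (prod_topology ?X ?X) (\<lambda>(x, y). (k x, k y))"
      by (simp add: continuous_map_prod_top k(2))
    then have "continuous_map (prod_topology T T) T (f \<circ> ((\<lambda>(x, y). x XOR y) \<circ> (\<lambda>(x, y). (k x, k y))))"
      by (intro continuous_map_compose[OF _ k(1)] continuous_map_compose[OF _ continuous_xor[OF F(1)]])
    moreover have "f \<circ> ((\<lambda>(x, y). x XOR y) \<circ> (\<lambda>(x, y). (k x, k y))) = (\<lambda>(x, y). x \<otimes>\<^bsub>G\<^esub> y)"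
      by (auto simp: fun_eq_iff G_def)
    ultimately show ?thesis by simp
  qed
  moreover have "continuous_map T T (\<lambda>x. inv\<^bsub>G\<^esub> x)"
    by (rule continuous_map_eq[OF continuous_map_id]) (use inv tT in \<open>auto simp: G_def\<close>)
  ultimately have "topological_group G T"
    using G tT by (simp add: topological_group_def G_def)
  moreover have "tychonoff_space T"
    by (rule tychonoff_homeomorphic[OF hs tychonoff_bit_topology[OF F(1)]])
  moreover have "\<not> metrizable_space T"
  proof -
    have "\<not> metrizable_space ?X"
      using not_metrizable_filter_space[OF F(1,3)] metrizable_space_subtopology
      unfolding filter_space_def by blast
    then show ?thesis using homeomorphic_metrizable_space[OF hs] by simp
  qed
  moreover have "R_omega1_factorizable ?X"
    using factorizable_bit_topology[OF F(1,2), of UNIV] by simp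
  then have "R_omega1_factorizable T" by (rule factorizable_homeomorphic[OF hom])
  ultimately show ?thesis by blast
qed

theorem mainTheorem1:
  assumes "infinite (UNIV :: 'a set)" and "infinite (UNIV :: 'b set)"
  shows
    "((\<exists>X :: 'a topology.
         tychonoff_space X \<and> \<not> metrizable_space X \<and> R_omega1_factorizable X)
      \<longleftrightarrow>
      (\<exists>X :: 'a topology.
         tychonoff_space X \<and> countable (topspace X) \<and> \<not> metrizable_space X \<and>
         R_omega1_factorizable X \<and> single_nonisolated_point X))
     \<and>
     ((\<exists>X :: 'a topology.
         tychonoff_space X \<and> countable (topspace X) \<and> \<not> metrizable_space X \<and>
         R_omega1_factorizable X \<and> single_nonisolated_point X)
      \<longleftrightarrow>
      (\<exists>X :: 'a topology.
         tychonoff_space X \<and> countable (topspace X) \<and> \<not> metrizable_space X \<and>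
         R_omega1_factorizable X \<and> has_weight X omega2 \<and> single_nonisolated_point X))
     \<and>
     ((\<exists>X :: 'a topology.
         tychonoff_space X \<and> countable (topspace X) \<and> \<not> metrizable_space X \<and>
         R_omega1_factorizable X \<and> has_weight X omega2 \<and> single_nonisolated_point X)
      \<longleftrightarrow>
      (\<exists>(G :: 'b monoid) (T :: 'b topology).
         topological_group G T \<and> tychonoff_space T \<and> \<not> metrizable_space T \<and>
         R_omega1_factorizable T))"
  (is "(?nonmetrizable \<longleftrightarrow> ?countable) \<and> (?countable \<longleftrightarrow> ?weight) \<and> (?weight \<longleftrightarrow> ?group)")
proof -
  let ?filter = "\<exists>F. free_filter F \<and> countably_refined F \<and> \<not> countably_based F"
  have "?nonmetrizable \<Longrightarrow> ?filter"
    using nonmetrizable_factorizable_imp_filter by metis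
  moreover have "?group \<Longrightarrow> ?filter"
    using nonmetrizable_factorizable_imp_filter by metis
  moreover have "?filter \<Longrightarrow> ?weight"
    using filter_imp_space[OF assms(1)] by blast
  moreover have "?filter \<Longrightarrow> ?group"
    using filter_imp_group[OF assms(2)] by blast
  moreover have "?weight \<Longrightarrow> ?countable" by blast
  moreover have "?countable \<Longrightarrow> ?nonmetrizable" by blast
  ultimately show ?thesis by argo
qed

end
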